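(* Let $k$ be a field of characteristic $2$, let $E=E_{c^2}$ be an elliptic curve over $k$ in $\mathbf{Z}/4\mathbf{Z}$-normal form $$(X_0+X_1+X_2+X_3)^2=c^2X_0X_2=c^2X_1X_3,\qquad \mathrm{O}=(1:0:0:1),$$ and let $P=(t_0:t_1:t_2:t_3)$ be a fixed point in $E(k)$, normalized so that $t_0=1$ or $t_1=1$. The Montgomery endomorphism on $\mathscr{K}(\Delta_P)$ can be computed with $4\mathbf{M}+5\mathbf{S}+1\mathbf{m}_t+1\mathbf{m}_c$ or with $4\mathbf{M}+4\mathbf{S}+1\mathbf{m}_t+2\mathbf{m}_c$.
   Context: $\mathscr{K}=E/\{[\pm1]\}$ is identified with $\mathbb{P}^1$ via the covering $E\to\mathbb{P}^1$, $(X_0:X_1:X_2:X_3)\mapsto(X_0:X_1)=(X_3:X_2)$; $\overline{Q}$ denotes the image of $Q$. $\Delta_P=\{(Q,R)\in E\times E\mid Q-R=P\}$ and $\mathscr{K}(\Delta_P)$ is its image in $\mathscr{K}\times\mathscr{K}=\mathbb{P}^1\times\mathbb{P}^1$. The Montgomery endomorphism on $\mathscr{K}(\Delta_P)$ is the map $(\overline{Q},\overline{R})\mapsto(\overline{2Q},\overline{Q+R})$, $(Q,R)\in\Delta_P$; computing it means computing projective coordinates of the two components of the image from projective coordinates $((U_0:U_1),(V_0:V_1))$ of the input. Costs: $\mathbf{M}$ is a multiplication in $k$, $\mathbf{S}$ a squaring in $k$, $\mathbf{m}_c$ a multiplication by a fixed constant of the curve ($c$ or a bounded power of $c$), $\mathbf{m}_t$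 a multiplication by a constant that depends on $P$. Field additions, and the construction of bounded powers of the fixed constant, are not counted. *)

theory Defs
  imports "HOL-Algebra.Algebraic_Closure_Type"
begin

section \<open>Projective points as classes of homogeneous coordinates\<close>

type_synonym 'a pt1 = "('a \<times> 'a) set"
type_synonym 'a pt3 = "('a \<times> 'a \<times> 'a \<times> 'a) set"

definition proj1 :: "'a::field \<Rightarrow> 'a \<Rightarrow> 'a pt1"
  where "proj1 a b = {(l * a, l * b) | l. l \<noteq> 0}"

definition proj3 :: "'a::field \<Rightarrow> 'a \<Rightarrow> 'a \<Rightarrow> 'a \<Rightarrow> 'a pt3"
  where "proj3 a b c d = {(l * a, l * b, l * c, l * d) | l. l \<noteq> 0}"


section \<open>Curves in Z/4Z-normal form\<close>

text \<open>The curve \<open>E\<^sub>e\<close>, with \<open>e\<close> the coefficient; the main statement uses \<open>e = c\<^sup>2\<close>.\<close>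

definition on_Z4 :: "'a::field \<Rightarrow> 'a \<Rightarrow> 'a \<Rightarrow> 'a \<Rightarrow> 'a \<Rightarrow> bool"
  where "on_Z4 e x0 x1 x2 x3 \<longleftrightarrow>
    (x0 + x1 + x2 + x3)\<^sup>2 = e * x0 * x2 \<and> e * x0 * x2 = e * x1 * x3"

definition Z4_points :: "'a::field \<Rightarrow> 'a pt3 set"
  where "Z4_points e =
    {proj3 x0 x1 x2 x3 | x0 x1 x2 x3. (x0, x1, x2, x3) \<noteq> (0, 0, 0, 0) \<and> on_Z4 e x0 x1 x2 x3}"

definition Z4_O :: "'a::field pt3"
  where "Z4_O = proj3 1 0 0 1"

text \<open>
  \<open>E\<^sub>e\<close> is an elliptic curve iff it is smooth of dimension one (a smooth complete intersection of two
  quadrics in three-space is geometrically connected of genus one, and \<open>Z4_O\<close> is a rational point).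
  This is the Jacobian criterion at all geometric points: the gradients of the two quadratic forms
  \<open>s\<^sup>2 - e x\<^sub>0 x\<^sub>2\<close> and \<open>s\<^sup>2 - e x\<^sub>1 x\<^sub>3\<close>, \<open>s = x\<^sub>0 + x\<^sub>1 + x\<^sub>2 + x\<^sub>3\<close>, are linearly independent. They
  have the same common zeros as \<open>on_Z4\<close>.
\<close>

definition elliptic_Z4 :: "'a::field \<Rightarrow> bool"
  where "elliptic_Z4 e \<longleftrightarrow>
    (\<forall>x0 x1 x2 x3 :: 'a alg_closure.
       (x0, x1, x2, x3) \<noteq> (0, 0, 0, 0) \<and> on_Z4 (to_ac e) x0 x1 x2 x3 \<longrightarrow>
       (let s = x0 + x1 + x2 + x3; d = to_ac e in
        \<forall>a b. a * (2 * s - d * x2) + b * (2 * s) = 0 \<and>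
              a * (2 * s) + b * (2 * s - d * x3) = 0 \<and>
              a * (2 * s - d * x0) + b * (2 * s) = 0 \<and>
              a * (2 * s) + b * (2 * s - d * x1) = 0 \<longrightarrow> a = 0 \<and> b = 0))"


section \<open>The group law\<close>

subsection \<open>Weierstrass curves\<close>

datatype 'a wpoint = Infinity | Affine 'a 'a

definition w_points :: "'a::field \<Rightarrow> 'a \<Rightarrow> 'a \<Rightarrow> 'a \<Rightarrow> 'a \<Rightarrow> 'a wpoint set"
  where "w_points a1 a2 a3 a4 a6 =
    insert Infinity {Affine x y | x y. y\<^sup>2 + a1 * x * y + a3 * y = x ^ 3 + a2 * x\<^sup>2 + a4 * x + a6}"

fun w_neg :: "'a::field \<Rightarrow> 'a \<Rightarrow> 'a wpoint \<Rightarrow> 'a wpoint"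
  where
    "w_neg a1 a3 Infinity = Infinity"
  | "w_neg a1 a3 (Affine x y) = Affine x (- y - a1 * x - a3)"

text \<open>Chord and tangent construction.\<close>

fun w_add :: "'a::field \<Rightarrow> 'a \<Rightarrow> 'a \<Rightarrow> 'a \<Rightarrow> 'a wpoint \<Rightarrow> 'a wpoint \<Rightarrow> 'a wpoint"
  where
    "w_add a1 a2 a3 a4 Infinity q = q"
  | "w_add a1 a2 a3 a4 (Affine x y) Infinity = Affine x y"
  | "w_add a1 a2 a3 a4 (Affine x1 y1) (Affine x2 y2) =
      (if x1 = x2 \<and> y1 + y2 + a1 * x2 + a3 = 0 then Infinity
       else
         let l = (if x1 = x2
                  then (3 * x1\<^sup>2 + 2 * a2 * x1 + a4 - a1 * y1) / (2 * y1 + a1 * x1 + a3)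
                  else (y2 - y1) / (x2 - x1));
             n = y1 - l * x1;
             x3 = l\<^sup>2 + a1 * l - a2 - x1 - x2
         in Affine x3 (- (l + a1) * x3 - n - a3))"

subsection \<open>Transport to the Z/4Z-normal form\<close>

text \<open>
  In characteristic two and for \<open>e \<noteq> 0\<close>, the Weierstrass model of \<open>(E\<^sub>e, Z4_O)\<close> is
  \<open>y\<^sup>2 + x y = x\<^sup>3 + e\<^sup>-\<^sup>2 x\<close>, with \<open>x = X\<^sub>0 / (e X\<^sub>1) = X\<^sub>3 / (e X\<^sub>2)\<close> and \<open>y = X\<^sub>3 / (e (X\<^sub>1 + X\<^sub>2))\<close>. The map
  below is the inverse isomorphism; its defining forms all vanish at \<open>(0, 0)\<close>, where the morphism
  takes the value \<open>(0:1:1:0)\<close>. An isomorphism of genus one curves preserving the base points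
  preserves the group laws, so transport along it yields the group law of \<open>E\<^sub>e\<close> with neutral
  element \<open>Z4_O\<close>.
\<close>

abbreviation Z4_model :: "'a::field \<Rightarrow> 'a wpoint set"
  where "Z4_model e \<equiv> w_points 1 0 0 (1 / e\<^sup>2) 0"

fun from_model :: "'a::field \<Rightarrow> 'a wpoint \<Rightarrow> 'a pt3"
  where
    "from_model e Infinity = Z4_O"
  | "from_model e (Affine x y) =
      (if x = 0 \<and> y = 0 then proj3 0 1 1 0
       else proj3 (e * x * (x + y)) (x + y) y (e * x * y))"

definition to_model :: "'a::field \<Rightarrow> 'a pt3 \<Rightarrow> 'a wpoint"
  where "to_model e = inv_into (Z4_model e) (from_model e)"

definition Z4_add :: "'a::field \<Rightarrow> 'a pt3 \<Rightarrow> 'a pt3 \<Rightarrow> 'a pt3"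
  where "Z4_add e Q R = from_model e (w_add 1 0 0 (1 / e\<^sup>2) (to_model e Q) (to_model e R))"

definition Z4_neg :: "'a::field \<Rightarrow> 'a pt3 \<Rightarrow> 'a pt3"
  where "Z4_neg e Q = from_model e (w_neg 1 0 (to_model e Q))"


section \<open>The Kummer curve and the Montgomery endomorphism\<close>

text \<open>
  The class of \<open>(X\<^sub>0:X\<^sub>1) = (X\<^sub>3:X\<^sub>2)\<close>: each of the two pairs represents the image wherever it is
  nonzero.
\<close>

definition kummer :: "'a::field pt3 \<Rightarrow> 'a pt1"
  where "kummer Q =
    {(a, b). (a, b) \<noteq> (0, 0) \<and>
       (\<exists>x0 x1 x2 x3. (x0, x1, x2, x3) \<in> Q \<and> ((a, b) = (x0, x1) \<or> (a, b) = (x3, x2)))}"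

definition Delta :: "'a::field \<Rightarrow> 'a pt3 \<Rightarrow> ('a pt3 \<times> 'a pt3) set"
  where "Delta e P =
    {(Q, R). Q \<in> Z4_points e \<and> R \<in> Z4_points e \<and> Z4_add e Q (Z4_neg e R) = P}"

definition kummer_Delta :: "'a::field \<Rightarrow> 'a pt3 \<Rightarrow> ('a pt1 \<times> 'a pt1) set"
  where "kummer_Delta e P = (\<lambda>(Q, R). (kummer Q, kummer R)) ` Delta e P"

text \<open>The Montgomery endomorphism, as its graph.\<close>

definition montgomery :: "'a::field \<Rightarrow> 'a pt3 \<Rightarrow> (('a pt1 \<times> 'a pt1) \<times> ('a pt1 \<times> 'a pt1)) set"
  where "montgomery e P =
    (\<lambda>(Q, R). ((kummer Q, kummer R), (kummer (Z4_add e Q Q), kummer (Z4_add e Q R)))) ` Delta e P"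


section \<open>Straight-line programs and their cost\<close>

text \<open>
  Instructions refer to earlier values by position and append one new value. \<open>MulC i j\<close> multiplies
  by \<open>c ^ i\<close>, \<open>MulT t j\<close> by the constant \<open>t\<close> of the ground field, which may depend on the fixed
  point.
\<close>

datatype 'a instr =
    Add nat nat
  | is_Mul: Mul nat nat
  | is_Sqr: Sqr nat
  | is_MulC: MulC nat nat
  | is_MulT: MulT 'a nat

text \<open>The four positions at the end are those of the output coordinates.\<close>

datatype 'a program = Program (code: "'a instr list") (outputs: "nat \<times> nat \<times> nat \<times> nat")

text \<open>Only \<open>c\<close> and the curve coefficient \<open>c\<^sup>2\<close> are allowed as fixed constants.\<close>

fun wf_instr :: "nat \<Rightarrow> 'a instr \<Rightarrow> bool"
  where
    "wf_instr n (Add i j) \<longleftrightarrow> i < n \<and> j < n"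
  | "wf_instr n (Mul i j) \<longleftrightarrow> i < n \<and> j < n"
  | "wf_instr n (Sqr i) \<longleftrightarrow> i < n"
  | "wf_instr n (MulC i j) \<longleftrightarrow> i \<in> {1, 2} \<and> j < n"
  | "wf_instr n (MulT t j) \<longleftrightarrow> j < n"

fun wf_program :: "'a program \<Rightarrow> bool"
  where "wf_program (Program is (o0, o1, o2, o3)) \<longleftrightarrow>
    (\<forall>n < length is. wf_instr (4 + n) (is ! n)) \<and> (\<forall>i \<in> {o0, o1, o2, o3}. i < 4 + length is)"

text \<open>
  Constants are taken from the ground field, while the inputs may lie in an extension, so that
  programs can be run on geometric points. On inputs from the ground field all operations take
  place there.
\<close>

fun value_of :: "'a::field \<Rightarrow> 'a alg_closure list \<Rightarrow> 'a instr \<Rightarrow> 'a alg_closure"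
  where
    "value_of c xs (Add i j) = xs ! i + xs ! j"
  | "value_of c xs (Mul i j) = xs ! i * xs ! j"
  | "value_of c xs (Sqr i) = (xs ! i)\<^sup>2"
  | "value_of c xs (MulC i j) = to_ac (c ^ i) * xs ! j"
  | "value_of c xs (MulT t j) = to_ac t * xs ! j"

definition run :: "'a::field \<Rightarrow> 'a alg_closure list \<Rightarrow> 'a instr list \<Rightarrow> 'a alg_closure list"
  where "run c = foldl (\<lambda>xs i. xs @ [value_of c xs i])"

definition cost_at_most :: "'a program \<Rightarrow> nat \<Rightarrow> nat \<Rightarrow> nat \<Rightarrow> nat \<Rightarrow> bool"
  where "cost_at_most p M S mt mc \<longleftrightarrow>
    length (filter is_Mul (code p)) \<le> M \<and> length (filter is_Sqr (code p)) \<le> S \<and>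
    length (filter is_MulT (code p)) \<le> mt \<and> length (filter is_MulC (code p)) \<le> mc"

text \<open>
  From any coordinates of any geometric point of \<open>kummer_Delta\<close>, the program has to compute
  coordinates of its image; membership in a class excludes \<open>(0, 0)\<close>.
\<close>

definition computes_montgomery :: "'a::field \<Rightarrow> 'a alg_closure pt3 \<Rightarrow> 'a program \<Rightarrow> bool"
  where "computes_montgomery c P p \<longleftrightarrow> wf_program p \<and>
    (\<forall>((x, y), (x', y')) \<in> montgomery (to_ac (c\<^sup>2)) P.
     \<forall>(U0, U1) \<in> x. \<forall>(V0, V1) \<in> y.
       let v = run c [U0, U1, V0, V1] (code p); (o0, o1, o2, o3) = outputs p
       in (v ! o0, v ! o1) \<in> x' \<and> (v ! o2, v ! o3) \<in> y')"


section \<open>Consistency of the definitions\<close>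

lemma char2_add_self: fixes x :: "'a::field" assumes "CHAR('a) = 2" shows "x + x = 0" 
proof -
  have "(of_nat 2 :: 'a) = 0" by (simp add: of_nat_eq_0_iff_char_dvd assms del: of_nat_numeral)
  hence "(2::'a) = 0" by simp
  thus ?thesis by (metis mult_2 mult_zero_left)
qed

lemma char2_two: assumes "CHAR('a::field) = 2" shows "(2::'a) = 0" 
  using char2_add_self[OF assms, of 1] by (simp add: one_add_one)

lemma char2_uminus: fixes x :: "'a::field" assumes "CHAR('a) = 2" shows "- x = x" 
  using char2_add_self[OF assms, of x] by (simp add: eq_neg_iff_add_eq_0)

lemma char2_diff: fixes x :: "'a::field" assumes "CHAR('a) = 2" shows "x - y = x + y"
  using char2_uminus[OF assms, of y] by (simp add: diff_conv_add_uminus del: add_uminus_conv_diff)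

lemma char2_add_left_self: fixes x :: "'a::field" assumes "CHAR('a) = 2" shows "x + (x + y) = y"
  using char2_add_self[OF assms, of x] by (simp flip: add.assoc)

lemmas char2_simps = char2_two char2_uminus char2_diff char2_add_self char2_add_left_self

lemma char2_add_eq_0_iff: fixes x :: "'a::field" assumes "CHAR('a) = 2" shows "x + y = 0 \<longleftrightarrow> x = y"
  using char2_diff[OF assms, of x y] by (metis eq_iff_diff_eq_0)

lemma elliptic_Z4_iff:
  fixes e :: "'a::field"
  assumes "CHAR('a) = 2"
  shows "elliptic_Z4 e \<longleftrightarrow> e \<noteq> 0"
proof
  have two: "(2 :: 'a alg_closure) = 0" using char2_two[where 'a="'a alg_closure"] assms by simp
  assume *: "elliptic_Z4 e"
  show "e \<noteq> 0"
  proof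
    assume [simp]: "e = 0"
    have "on_Z4 (to_ac e) 1 1 0 (0::'a alg_closure)"
      using two by (simp add: on_Z4_def)
    then show False
      using *[unfolded elliptic_Z4_def Let_def, rule_format, of 1 1 0 0 1 0] by (simp add: two)
  qed
next
  have two: "(2 :: 'a alg_closure) = 0" using char2_two[where 'a="'a alg_closure"] assms by simp
  assume e: "e \<noteq> 0"
  show "elliptic_Z4 e"
    unfolding elliptic_Z4_def Let_def
  proof (intro allI impI)
    fix x0 x1 x2 x3 a b :: "'a alg_closure"
    assume x: "(x0, x1, x2, x3) \<noteq> (0, 0, 0, 0) \<and> on_Z4 (to_ac e) x0 x1 x2 x3"
    assume "a * (2 * (x0 + x1 + x2 + x3) - to_ac e * x2) + b * (2 * (x0 + x1 + x2 + x3)) = 0 \<and>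
       a * (2 * (x0 + x1 + x2 + x3)) + b * (2 * (x0 + x1 + x2 + x3) - to_ac e * x3) = 0 \<and>
       a * (2 * (x0 + x1 + x2 + x3) - to_ac e * x0) + b * (2 * (x0 + x1 + x2 + x3)) = 0 \<and>
       a * (2 * (x0 + x1 + x2 + x3)) + b * (2 * (x0 + x1 + x2 + x3) - to_ac e * x1) = 0"
    then have eqs: "a * x2 = 0" "b * x3 = 0" "a * x0 = 0" "b * x1 = 0"
      using e by (simp_all add: two)
    have 1: "\<not> (x0 = 0 \<and> x2 = 0)"
    proof
      assume "x0 = 0 \<and> x2 = 0"
      then have "x1 + x3 = 0" "x1 * x3 = 0" using x e by (auto simp: on_Z4_def)
      then show False using x \<open>x0 = 0 \<and> x2 = 0\<close> by auto
    qed
    have 2: "\<not> (x1 = 0 \<and> x3 = 0)"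
    proof
      assume "x1 = 0 \<and> x3 = 0"
      then have "x0 + x2 = 0" "x0 * x2 = 0" using x e by (auto simp: on_Z4_def)
      then show False using x \<open>x1 = 0 \<and> x3 = 0\<close> by auto
    qed
    from 1 2 eqs show "a = 0 \<and> b = 0" by auto
  qed
qed

lemma proj1_eq_iff:
  fixes a b c d :: "'a::field"
  assumes "(a, b) \<noteq> (0, 0)" "(c, d) \<noteq> (0, 0)"
  shows "proj1 a b = proj1 c d \<longleftrightarrow> a * d = b * c"
proof
  assume "proj1 a b = proj1 c d"
  moreover have "(a, b) \<in> proj1 a b" unfolding proj1_def by (auto intro: exI[of _ 1])
  ultimately show "a * d = b * c" by (auto simp: proj1_def)
next
  assume *: "a * d = b * c"
  have "\<exists>l. l \<noteq> 0 \<and> a = l * c \<and> b = l * d"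
  proof (cases "c = 0")
    case True
    then show ?thesis using assms * by (intro exI[of _ "b / d"]) auto
  next
    case False
    then have "a \<noteq> 0" using assms * by auto
    with False show ?thesis using * by (intro exI[of _ "a / c"]) (auto simp: field_simps)
  qed
  then obtain l where l: "l \<noteq> 0" "a = l * c" "b = l * d" by blast
  show "proj1 a b = proj1 c d"
    unfolding proj1_def l(2,3)
  proof safe
    fix m :: 'a assume "m \<noteq> 0"
    then show "\<exists>l'. (m * (l * c), m * (l * d)) = (l' * c, l' * d) \<and> l' \<noteq> 0"
      using l by (intro exI[of _ "m * l"]) auto
    show "\<exists>l'. (m * c, m * d) = (l' * (l * c), l' * (l * d)) \<and> l' \<noteq> 0"
      using l \<open>m \<noteq> 0\<close> by (intro exI[of _ "m / l"]) auto
  qed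
qed

lemma proj3_eq_iff:
  "proj3 a b c d = proj3 a' b' c' d' \<longleftrightarrow>
    (\<exists>l. l \<noteq> 0 \<and> a = l * a' \<and> b = l * b' \<and> c = l * c' \<and> d = l * d')"
proof
  assume "proj3 a b c d = proj3 a' b' c' d'"
  moreover have "(a, b, c, d) \<in> proj3 a b c d" unfolding proj3_def by (auto intro: exI[of _ 1])
  ultimately have "(a, b, c, d) \<in> proj3 a' b' c' d'" by simp
  then show "\<exists>l. l \<noteq> 0 \<and> a = l * a' \<and> b = l * b' \<and> c = l * c' \<and> d = l * d'"
    unfolding proj3_def by auto
next
  assume "\<exists>l. l \<noteq> 0 \<and> a = l * a' \<and> b = l * b' \<and> c = l * c' \<and> d = l * d'"
  then obtain l where l: "l \<noteq> 0" "a = l * a'" "b = l * b'" "c = l * c'" "d = l * d'" by blast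
  show "proj3 a b c d = proj3 a' b' c' d'"
    unfolding proj3_def l(2-)
  proof safe
    fix m :: 'a assume "m \<noteq> 0"
    then show "\<exists>n. (m * (l * a'), m * (l * b'), m * (l * c'), m * (l * d')) =
        (n * a', n * b', n * c', n * d') \<and> n \<noteq> 0"
      using l by (intro exI[of _ "m * l"]) auto
    show "\<exists>n. (m * a', m * b', m * c', m * d') =
        (n * (l * a'), n * (l * b'), n * (l * c'), n * (l * d')) \<and> n \<noteq> 0"
      using l \<open>m \<noteq> 0\<close> by (intro exI[of _ "m / l"]) auto
  qed
qed

lemma from_model_in_Z4_points:
  fixes e :: "'a::field"
  assumes ch: "CHAR('a) = 2" and e: "e \<noteq> 0" and p: "p \<in> Z4_model e"
  shows "from_model e p \<in> Z4_points e"
proof (cases p)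
  case Infinity
  have "on_Z4 e 1 0 0 (1 :: 'a)" by (simp add: on_Z4_def char2_simps[OF ch])
  then show ?thesis unfolding Z4_points_def Infinity from_model.simps Z4_O_def
    by (intro CollectI exI[of _ "1::'a"] exI[of _ "0::'a"]) auto
next
  case (Affine x y)
  have eq: "y\<^sup>2 + x * y = x ^ 3 + x / e\<^sup>2" using p by (simp add: Affine w_points_def)
  show ?thesis
  proof (cases "x = 0 \<and> y = 0")
    case True
    have "on_Z4 e 0 1 1 (0 :: 'a)" by (simp add: on_Z4_def char2_simps[OF ch])
    then show ?thesis unfolding Z4_points_def Affine using True
      by simp (intro exI[of _ "1::'a"] exI[of _ "0::'a"], auto)
  next
    case False
    have s: "e * x * (x + y) + (x + y) + y + e * x * y = e * x\<^sup>2 + x"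
      by (simp add: algebra_simps power2_eq_square char2_simps[OF ch])
    have 1: "e * (e * x * (x + y)) * y = e\<^sup>2 * x * (y\<^sup>2 + x * y)"
      by (simp add: algebra_simps power2_eq_square)
    have 2: "e\<^sup>2 * x * (x ^ 3 + x / e\<^sup>2) = (e * x\<^sup>2 + x)\<^sup>2"
      using e by (simp add: field_simps power2_eq_square power3_eq_cube char2_simps[OF ch])
    have 3: "e * (x + y) * (e * x * y) = e * (e * x * (x + y)) * y" by (simp only: mult_ac)
    have "on_Z4 e (e * x * (x + y)) (x + y) y (e * x * y)"
      unfolding on_Z4_def s 3 by (simp only: 1 eq 2)
    moreover have "(e * x * (x + y), x + y, y, e * x * y) \<noteq> (0, 0, 0, 0)" using False by auto
    ultimately have "proj3 (e * x * (x + y)) (x + y) y (e * x * y) \<in> Z4_points e"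
      unfolding Z4_points_def by blast
    then show ?thesis unfolding Affine from_model.simps if_not_P[OF False] .
  qed
qed

lemma inj_on_from_model:
  fixes e :: "'a::field"
  assumes ch: "CHAR('a) = 2" and e: "e \<noteq> 0"
  shows "inj_on (from_model e) (Z4_model e)"
proof (rule inj_onI)
  fix p q assume p: "p \<in> Z4_model e" and q: "q \<in> Z4_model e" and eq: "from_model e p = from_model e q"
  have O: "proj3 (e * x * (x + y)) (x + y) y (e * x * y) \<noteq> proj3 1 0 0 1" 
    if "\<not> (x = 0 \<and> y = 0)" for x y
    using that by (auto simp: proj3_eq_iff)
  have T: "proj3 (e * x * (x + y)) (x + y) y (e * x * y) \<noteq> proj3 0 1 1 0"
    if "\<not> (x = 0 \<and> y = 0)" "Affine x y \<in> Z4_model e" for x y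
    using that e by (auto simp: proj3_eq_iff w_points_def)
  have OT: "proj3 0 1 1 0 \<noteq> proj3 1 0 0 (1::'a)" by (auto simp: proj3_eq_iff)
  show "p = q"
  proof (cases "p = Infinity \<or> q = Infinity")
    case True
    have "from_model e (Affine x y) \<noteq> Z4_O" for x y
      unfolding from_model.simps Z4_O_def using O[of x y] OT by (cases "x = 0 \<and> y = 0") (simp_all only: if_P if_not_P not_False_eq_True)
    then have "from_model e r = Z4_O \<longleftrightarrow> r = Infinity" for r
      by (cases r) (simp_all del: from_model.simps(2))
    then show ?thesis using eq True by (metis from_model.simps(1))
  next
    case False
    then obtain x y x' y' where pq: "p = Affine x y" "q = Affine x' y'"
      by (meson wpoint.exhaust)
    show "p = q"
    proof (cases "(x = 0 \<and> y = 0) \<or> (x' = 0 \<and> y' = 0)")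
      case True
      have "(x = 0 \<and> y = 0) \<and> (x' = 0 \<and> y' = 0)"
      proof (rule ccontr)
        assume "\<not> ?thesis"
        then consider "x = 0 \<and> y = 0" "\<not> (x' = 0 \<and> y' = 0)" | "\<not> (x = 0 \<and> y = 0)" "x' = 0 \<and> y' = 0"
          using True by blast
        then show False
        proof cases
          case 1
          show False using T[OF 1(2) q[unfolded pq]] eq 1 unfolding pq from_model.simps by (simp split: if_splits)
        next
          case 2
          show False using T[OF 2(1) p[unfolded pq]] eq 2 unfolding pq from_model.simps by (simp split: if_splits)
        qed
      qed
      then show ?thesis using pq by simp
    next
      case False
      then have "proj3 (e * x * (x + y)) (x + y) y (e * x * y) =
          proj3 (e * x' * (x' + y')) (x' + y') y' (e * x' * y')"
        using eq unfolding pq from_model.simps by (simp split: if_splits)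
      then obtain l where l: "l \<noteq> 0" "e * x * (x + y) = l * (e * x' * (x' + y'))"
        "x + y = l * (x' + y')" "y = l * y'" "e * x * y = l * (e * x' * y')"
        unfolding proj3_eq_iff by blast
      have x: "x = l * x'" using l(3) unfolding l(4) by (simp add: distrib_left)
      have eqs: "x = 0 \<Longrightarrow> y = 0" "x' = 0 \<Longrightarrow> y' = 0"
        using p q by (simp_all add: pq w_points_def)
      then have "x \<noteq> 0" "x' \<noteq> 0" using False by auto
      have "x = x'"
      proof (cases "y' = 0")
        case True
        then have "e * x * x = l * (e * x' * x')" using l(2) l(4) by simp
        then have "e * x * x = e * x' * x" unfolding x by (simp add: mult_ac)
        then show ?thesis using e \<open>x \<noteq> 0\<close> by simp
      next
        case False
        have "e * x * y = e * x' * y" using l(5) unfolding l(4) by (simp add: mult_ac)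
        then show ?thesis using False l(1,4) e by simp
      qed
      then have "l = 1" using x \<open>x \<noteq> 0\<close> by simp
      then show ?thesis using l(4) \<open>x = x'\<close> pq by simp
    qed
  qed
qed

lemma from_model_surj:
  fixes e :: "'a::field"
  assumes ch: "CHAR('a) = 2" and e: "e \<noteq> 0" and Q: "Q \<in> Z4_points e"
  shows "Q \<in> from_model e ` Z4_model e"
proof -
  obtain x0 x1 x2 x3 where Q: "Q = proj3 x0 x1 x2 x3" and nz: "(x0, x1, x2, x3) \<noteq> (0, 0, 0, 0)"
    and on: "on_Z4 e x0 x1 x2 x3" using Q unfolding Z4_points_def by blast
  have c1: "(x0 + x1 + x2 + x3)\<^sup>2 = e * x0 * x2" and c2: "x0 * x2 = x1 * x3"
    using on e by (auto simp: on_Z4_def)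
  consider "x1 = 0" "x2 = 0" | "x0 = 0" "x3 = 0" | "\<not> (x1 = 0 \<and> x2 = 0)" "\<not> (x0 = 0 \<and> x3 = 0)"
    by blast
  then show ?thesis
  proof cases
    case 1
    then have "x0 = x3" using c1 by (simp add: char2_add_eq_0_iff[OF ch])
    then have "Q = from_model e Infinity" using 1 nz Q by (auto simp: Z4_O_def proj3_eq_iff)
    then show ?thesis by (auto simp: w_points_def)
  next
    case 2
    then have "x1 = x2" using c1 by (simp add: char2_add_eq_0_iff[OF ch])
    then have "Q = from_model e (Affine 0 0)" using 2 nz Q by (auto simp: proj3_eq_iff)
    moreover have "Affine 0 0 \<in> Z4_model e" by (simp add: w_points_def)
    ultimately show ?thesis by blast
  next
    case 3
    define s where "s = x1 + x2"
    define x where "x = (if x1 \<noteq> 0 then x0 / (e * x1) else x3 / (e * x2))"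
    have x: "e * x * x1 = x0" "e * x * x2 = x3"
      using 3 e c2 by (auto simp: x_def field_simps)
    have "x \<noteq> 0" using x 3 by auto
    have "s \<noteq> 0"
    proof
      assume "s = 0"
      then have *: "x1 = x2" by (simp add: s_def char2_add_eq_0_iff[OF ch])
      then have "x0 = x3" using x by simp
      then have "e * x0 * x2 = 0" using c1 * by (simp add: char2_simps[OF ch] algebra_simps)
      then show False using * 3 \<open>x0 = x3\<close> e by auto
    qed
    have c3: "s\<^sup>2 * (e * x + 1)\<^sup>2 = e\<^sup>2 * x * (x1 * x2)"
      using c1 unfolding s_def x[symmetric]
      by (simp add: algebra_simps power2_eq_square)
    define y where "y = x * x2 / s"
    have xy: "x + y = x * x1 / s"
      using \<open>s \<noteq> 0\<close> unfolding y_def by (simp add: field_simps s_def char2_simps[OF ch])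
    have "y\<^sup>2 + x * y = y * (x + y)" by (simp add: power2_eq_square algebra_simps)
    also have "\<dots> = x * (e\<^sup>2 * x * (x1 * x2)) / (s\<^sup>2 * e\<^sup>2)"
      using e unfolding xy unfolding y_def by (simp add: field_simps power2_eq_square)
    also have "\<dots> = x * (e * x + 1)\<^sup>2 / e\<^sup>2"
      using \<open>s \<noteq> 0\<close> e unfolding c3[symmetric] by (simp add: field_simps power2_eq_square)
    also have "\<dots> = x ^ 3 + x / e\<^sup>2"
      using e by (simp add: field_simps power2_eq_square power3_eq_cube char2_simps[OF ch])
    finally have "Affine x y \<in> Z4_model e" by (simp add: w_points_def)
    moreover have "Q = from_model e (Affine x y)"
      unfolding Q using \<open>x \<noteq> 0\<close> apply (simp add: proj3_eq_iff xy)
      apply (rule exI[of _ "s / x"])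
      using \<open>s \<noteq> 0\<close> x unfolding y_def by (auto simp: field_simps)
    ultimately show ?thesis by blast
  qed
qed

text \<open>The transport is along a bijection, and negation is the reversal of coordinates.\<close>

lemma bij_betw_from_model:
  fixes e :: "'a::field"
  assumes "CHAR('a) = 2" "e \<noteq> 0"
  shows "bij_betw (from_model e) (Z4_model e) (Z4_points e)"
  using inj_on_from_model[OF assms] from_model_surj[OF assms] from_model_in_Z4_points[OF assms]
  unfolding bij_betw_def by blast

lemma Z4_neg_proj3:
  fixes e :: "'a::field"
  assumes ch: "CHAR('a) = 2" and e: "e \<noteq> 0"
    and "(x0, x1, x2, x3) \<noteq> (0, 0, 0, 0)" "on_Z4 e x0 x1 x2 x3"
  shows "Z4_neg e (proj3 x0 x1 x2 x3) = proj3 x3 x2 x1 x0"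
proof -
  have "proj3 x0 x1 x2 x3 \<in> Z4_points e" using assms(3,4) unfolding Z4_points_def by blast
  then obtain p where p: "p \<in> Z4_model e" "proj3 x0 x1 x2 x3 = from_model e p"
    using from_model_surj[OF ch e] by blast
  have tm: "to_model e (proj3 x0 x1 x2 x3) = p"
    unfolding to_model_def p(2) using inj_on_from_model[OF ch e] p(1) by (rule inv_into_f_f)
  have sw: "proj3 x3 x2 x1 x0 = proj3 d c b a" if "proj3 x0 x1 x2 x3 = proj3 a b c d" for a b c d
    using that unfolding proj3_eq_iff by blast
  show ?thesis
  proof (cases p)
    case Infinity
    then show ?thesis using sw[of 1 0 0 1] p(2) tm by (simp add: Z4_neg_def Z4_O_def)
  next
    case (Affine x y)
    have *: "- y - x = x + y" by (simp add: char2_simps[OF ch] add_ac)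
    have **: "x + (x + y) = y" by (simp add: char2_simps[OF ch])
    show ?thesis
    proof (cases "x = 0 \<and> y = 0")
      case True
      then show ?thesis using sw[of 0 1 1 0] p(2) tm Affine by (simp add: Z4_neg_def)
    next
      case False
      then have nz: "\<not> (x = 0 \<and> x + y = 0)" by auto
      have fm: "from_model e (Affine x y) = proj3 (e * x * (x + y)) (x + y) y (e * x * y)"
        unfolding from_model.simps(2) by (rule if_not_P[OF False])
      have "from_model e (Affine x (x + y)) = proj3 (e * x * y) y (x + y) (e * x * (x + y))"
        by (subst from_model.simps(2), subst if_not_P[OF nz]) (simp only: **)
      then show ?thesis using sw[OF p(2)[unfolded Affine fm]] tm Affine
        by (simp add: Z4_neg_def * del: from_model.simps)
    qed
  qed
qed

lemma kummer_proj3: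
  assumes "x0 * x2 = x1 * x3"
  shows "(x0, x1) \<noteq> (0, 0) \<Longrightarrow> kummer (proj3 x0 x1 x2 x3) = proj1 x0 x1"
    and "(x3, x2) \<noteq> (0, 0) \<Longrightarrow> kummer (proj3 x0 x1 x2 x3) = proj1 x3 x2"
proof -
  have k: "kummer (proj3 x0 x1 x2 x3) = (proj1 x0 x1 \<union> proj1 x3 x2) - {(0, 0)}"
    unfolding kummer_def proj3_def proj1_def by (auto; blast)
  have 0: "proj1 0 0 = {(0, 0 :: 'a)}" by (auto simp: proj1_def intro: exI[of _ 1])
  have n: "proj1 a b - {(0, 0)} = proj1 a b" if "(a, b) \<noteq> (0, 0 :: 'a)" for a b
    using that by (auto simp: proj1_def)
  have e: "proj1 x0 x1 = proj1 x3 x2" if "(x0, x1) \<noteq> (0, 0)" "(x3, x2) \<noteq> (0, 0)"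
    using proj1_eq_iff[OF that] assms by simp
  show "kummer (proj3 x0 x1 x2 x3) = proj1 x0 x1" if nz: "(x0, x1) \<noteq> (0, 0)"
  proof (cases "(x3, x2) = (0, 0)")
    case True
    then have "proj1 x3 x2 = {(0, 0)}" using 0 by simp
    then show ?thesis unfolding k Un_Diff n[OF nz] by simp
  next
    case False
    show ?thesis unfolding k Un_Diff n[OF nz] n[OF False] e[OF nz False] by simp
  qed
  show "kummer (proj3 x0 x1 x2 x3) = proj1 x3 x2" if nz: "(x3, x2) \<noteq> (0, 0)"
  proof (cases "(x0, x1) = (0, 0)")
    case True
    then have "proj1 x0 x1 = {(0, 0)}" using 0 by simp
    then show ?thesis unfolding k Un_Diff n[OF nz] by simp
  next
    case False
    show ?thesis unfolding k Un_Diff n[OF nz] n[OF False] e[OF False nz] by simp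
  qed
qed

lemma kummer_from_model:
  fixes e :: "'a::field"
  assumes ch: "CHAR('a) = 2" and e: "e \<noteq> 0" and p: "Affine x y \<in> Z4_model e"
  shows "kummer (from_model e (Affine x y)) = proj1 (e * x) 1"
proof (cases "x = 0 \<and> y = 0")
  case True
  then show ?thesis using kummer_proj3(1)[of "0::'a" 1 1 0] by simp
next
  case False
  have fm: "from_model e (Affine x y) = proj3 (e * x * (x + y)) (x + y) y (e * x * y)"
    unfolding from_model.simps(2) by (rule if_not_P[OF False])
  have eq: "e * x * (x + y) * y = (x + y) * (e * x * y)" by (simp add: mult_ac)
  show ?thesis
  proof (cases "y = 0")
    case True
    then have "x + y \<noteq> 0" using False by simp
    then have nz: "(e * x * (x + y), x + y) \<noteq> (0, 0)" by simp
    show ?thesis unfolding fm kummer_proj3(1)[OF eq nz]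
      using nz by (subst proj1_eq_iff) (simp_all add: mult_ac)
  next
    case y: False
    then have nz: "(e * x * y, y) \<noteq> (0, 0)" by simp
    show ?thesis unfolding fm kummer_proj3(2)[OF eq nz]
      using nz by (subst proj1_eq_iff) (simp_all add: mult_ac)
  qed
qed

lemma kummer_Z4_O: "kummer Z4_O = proj1 1 0"
  unfolding Z4_O_def by (rule kummer_proj3(1)) simp_all

text \<open>The fibres of \<open>kummer\<close> are the orbits of negation.\<close>

lemma kummer_eq_iff:
  fixes e :: "'a::field"
  assumes ch: "CHAR('a) = 2" and e: "e \<noteq> 0" and Q: "Q \<in> Z4_points e" and R: "R \<in> Z4_points e"
  shows "kummer Q = kummer R \<longleftrightarrow> R = Q \<or> R = Z4_neg e Q"
proof -
  obtain q where q: "q \<in> Z4_model e" "Q = from_model e q" using from_model_surj[OF ch e Q] by blast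
  obtain r where r: "r \<in> Z4_model e" "R = from_model e r" using from_model_surj[OF ch e R] by blast
  have tm: "to_model e Q = q"
    unfolding to_model_def q(2) using inj_on_from_model[OF ch e] q(1) by (rule inv_into_f_f)
  have neg: "w_neg 1 0 q \<in> Z4_model e"
  proof (cases q)
    case (Affine x y)
    have "(- y - x)\<^sup>2 + x * (- y - x) = y\<^sup>2 + x * y" by (simp add: power2_eq_square algebra_simps)
    then show ?thesis using q(1) unfolding Affine by (simp add: w_points_def)
  qed (simp add: w_points_def)
  have "kummer Q = kummer R \<longleftrightarrow> r = q \<or> r = w_neg 1 0 q"
  proof (cases "q = Infinity \<or> r = Infinity")
    case True
    have "kummer (from_model e s) = proj1 1 0 \<longleftrightarrow> s = Infinity" if "s \<in> Z4_model e" for s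
    proof (cases s)
      case Infinity
      then show ?thesis by (simp add: kummer_Z4_O)
    next
      case (Affine x y)
      show ?thesis using that unfolding Affine
        by (subst kummer_from_model[OF ch e]) (simp_all add: proj1_eq_iff)
    qed
    from this[OF q(1)] this[OF r(1)] show ?thesis unfolding q(2) r(2)
      using True by (cases q; cases r) (auto simp del: from_model.simps(2) simp: kummer_Z4_O)
  next
    case False
    then obtain x y x' y' where qr: "q = Affine x y" "r = Affine x' y'"
      by (meson wpoint.exhaust)
    have "kummer Q = kummer R \<longleftrightarrow> x = x'"
      using q r e unfolding qr by (simp add: kummer_from_model[OF ch e] proj1_eq_iff del: from_model.simps)
    also have "\<dots> \<longleftrightarrow> x' = x \<and> (y' - y) * (y' - (- y - x)) = 0"
    proof -
      have "y\<^sup>2 + x * y = y'\<^sup>2 + x' * y'" if "x = x'"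
        using q(1) r(1) that unfolding qr by (simp add: w_points_def)
      moreover have "(y' - y) * (y' - (- y - x)) = (y'\<^sup>2 + x * y') - (y\<^sup>2 + x * y)"
        by (simp add: power2_eq_square algebra_simps)
      ultimately show ?thesis by auto
    qed
    finally show ?thesis unfolding qr by auto
  qed
  also have "\<dots> \<longleftrightarrow> R = Q \<or> R = Z4_neg e Q"
    unfolding Z4_neg_def tm unfolding q(2) r(2)
    using inj_on_eq_iff[OF inj_on_from_model[OF ch e] r(1) q(1)]
      inj_on_eq_iff[OF inj_on_from_model[OF ch e] r(1) neg] by simp
  finally show ?thesis .
qed

lemma Domain_montgomery: "Domain (montgomery e P) = kummer_Delta e P"
  unfolding montgomery_def kummer_Delta_def by force

end

theory Submission
  imports Defs
begin

text \<open>
  Let \<open>u\<close>, \<open>v\<close>, \<open>s\<close>, \<open>t\<close> be the Kummer coordinates of \<open>Q\<close>, \<open>R\<close>, \<open>Q + R\<close>, \<open>Q - R\<close>, and put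
  \<open>A = U\<^sub>0 V\<^sub>0\<close>, \<open>B = U\<^sub>1 V\<^sub>1\<close>, \<open>C = U\<^sub>0 V\<^sub>1 + U\<^sub>1 V\<^sub>0\<close>. The chord construction gives
  \<open>s t = (A + B)\<^sup>2 / C\<^sup>2\<close> and \<open>s + t = c\<^sup>2 A B / C\<^sup>2\<close>, and doubling sends \<open>u\<close> to
  \<open>(U\<^sub>0 + U\<^sub>1)\<^sup>4 / (c U\<^sub>0 U\<^sub>1)\<^sup>2\<close>, at cost \<open>1M + 3S + 1m\<^sub>c\<close>. Reading \<open>s\<close> off the product, with
  \<open>C = (U\<^sub>0 + U\<^sub>1) (V\<^sub>0 + V\<^sub>1) + A + B\<close>, costs a further \<open>3M + 2S + 1m\<^sub>t\<close>. Eliminating \<open>C\<^sup>2\<close> instead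
  gives \<open>s = (A + B)\<^sup>2 / (c\<^sup>2 A B + t\<^sub>1 (A + B)\<^sup>2)\<close> for \<open>t\<^sub>0 = 1\<close>, which trades a squaring for a
  multiplication by \<open>c\<^sup>2\<close>; for \<open>t\<^sub>1 = 1\<close> the sum gives \<open>s = (c\<^sup>2 A B + t\<^sub>0 C\<^sup>2) / C\<^sup>2\<close>, and
  \<open>A B = (U\<^sub>0 V\<^sub>1) (U\<^sub>1 V\<^sub>0)\<close> keeps the cost the same.
\<close>

section \<open>Coordinates on the Kummer line\<close>

text \<open>This is the test applied to every coordinate formula below: one cross-multiplication
  identity, and a separate argument that the two outputs do not vanish together.\<close>

lemma mem_proj1_iff:
  fixes a b s t :: "'a::field"
  assumes "(s, t) \<noteq> (0, 0)"
  shows "(a, b) \<in> proj1 s t \<longleftrightarrow> (a, b) \<noteq> (0, 0) \<and> a * t = b * s"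
proof
  assume "(a, b) \<in> proj1 s t"
  then show "(a, b) \<noteq> (0, 0) \<and> a * t = b * s" using assms by (auto simp: proj1_def)
next
  assume *: "(a, b) \<noteq> (0, 0) \<and> a * t = b * s"
  then have "proj1 a b = proj1 s t" using proj1_eq_iff[of a b s t] assms by blast
  moreover have "(a, b) \<in> proj1 a b" unfolding proj1_def by (auto intro: exI[of _ 1])
  ultimately show "(a, b) \<in> proj1 s t" by simp
qed

text \<open>Stated for arbitrary \<open>x\<close> and \<open>y\<close>, because applying \<open>kummer_from_model\<close> to sums would require
  closure of \<^const>\<open>w_add\<close>.\<close>

lemma kummer_from_model_Affine:
  fixes e :: "'a::field"
  shows "kummer (from_model e (Affine x y)) = proj1 (e * x) 1"
proof (cases "x = 0 \<and> y = 0")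
  case True
  then show ?thesis using kummer_proj3(1)[of "0::'a" 1 1 0] by simp
next
  case False
  have fm: "from_model e (Affine x y) = proj3 (e * x * (x + y)) (x + y) y (e * x * y)"
    unfolding from_model.simps(2) by (rule if_not_P[OF False])
  have eq: "e * x * (x + y) * y = (x + y) * (e * x * y)" by (simp add: mult_ac)
  show ?thesis
  proof (cases "y = 0")
    case True
    then have nz: "(e * x * (x + y), x + y) \<noteq> (0, 0)" using False by simp
    show ?thesis unfolding fm kummer_proj3(1)[OF eq nz]
      using nz by (subst proj1_eq_iff) (simp_all add: mult_ac)
  next
    case y: False
    then have nz: "(e * x * y, y) \<noteq> (0, 0)" by simp
    show ?thesis unfolding fm kummer_proj3(2)[OF eq nz]
      using nz by (subst proj1_eq_iff) (simp_all add: mult_ac)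
  qed
qed

lemma mem_kummer_from_model:
  fixes e :: "'a::field"
  shows "(a, b) \<in> kummer (from_model e Infinity) \<longleftrightarrow> a \<noteq> 0 \<and> b = 0"
    and "(a, b) \<in> kummer (from_model e (Affine x y)) \<longleftrightarrow> b \<noteq> 0 \<and> a = e * x * b"
proof -
  show "(a, b) \<in> kummer (from_model e Infinity) \<longleftrightarrow> a \<noteq> 0 \<and> b = 0"
    by (auto simp: kummer_Z4_O mem_proj1_iff)
  show "(a, b) \<in> kummer (from_model e (Affine x y)) \<longleftrightarrow> b \<noteq> 0 \<and> a = e * x * b"
    unfolding kummer_from_model_Affine by (subst mem_proj1_iff) (auto simp: mult_ac)
qed

lemma ex_mem_kummer_from_model:
  fixes e :: "'a::field"
  obtains a b where "(a, b) \<in> kummer (from_model e p)"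
proof (cases p)
  case Infinity
  then have "(1, 0) \<in> kummer (from_model e p)" by (simp only: mem_kummer_from_model, simp)
  then show ?thesis by (rule that)
next
  case (Affine x y)
  then have "(e * x, 1) \<in> kummer (from_model e p)" by (simp only: mem_kummer_from_model, simp)
  then show ?thesis by (rule that)
qed

lemma mem_kummer_nonzero:
  "(a, b) \<in> kummer Q \<Longrightarrow> (a, b) \<noteq> (0, 0)"
  by (simp add: kummer_def)

lemma kummer_from_model_eq_proj1:
  fixes e :: "'a::field"
  assumes "(a, b) \<in> kummer (from_model e p)"
  shows "kummer (from_model e p) = proj1 a b"
proof -
  obtain s t where st: "(s, t) \<noteq> (0, 0)" "kummer (from_model e p) = proj1 s t"
  proof (cases p)
    case Infinity
    then show ?thesis using that[of 1 0] by (simp add: kummer_Z4_O)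
  next
    case (Affine x y)
    show ?thesis using that[of "e * x" 1] unfolding Affine kummer_from_model_Affine by simp
  qed
  then show ?thesis using assms by (simp add: mem_proj1_iff proj1_eq_iff mult_ac)
qed


section \<open>The biquadratic relations between sum and difference\<close>

text \<open>In characteristic two the tangent slope is l = (x^2 + b + y) / x and the new abscissa is
  l^2 + l. Once x^2 is cleared, y occurs only through the curve equation, whose two sides
  cancel.\<close>

lemma w_add_double_x:
  fixes x y b :: "'a::field"
  assumes ch: "CHAR('a) = 2" and "x \<noteq> 0" and on: "y\<^sup>2 + x * y = x ^ 3 + b * x"
  obtains z where "w_add 1 0 0 b (Affine x y) (Affine x y) =
      Affine ((x\<^sup>2 + b)\<^sup>2 / x\<^sup>2) z"
proof -
  define l where "l = (x\<^sup>2 + b + y) / x"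
  have lx: "l * x = x\<^sup>2 + b + y" using \<open>x \<noteq> 0\<close> by (simp add: l_def)
  have "(l\<^sup>2 + l) * x\<^sup>2 = (l * x)\<^sup>2 + (l * x) * x" by (simp add: power2_eq_square algebra_simps)
  also have "\<dots> = (x\<^sup>2 + b)\<^sup>2 + (y\<^sup>2 + x * y) + (x^3 + b * x)"
    unfolding lx by (simp add: power2_eq_square power3_eq_cube algebra_simps char2_simps[OF ch])
  also have "\<dots> = (x\<^sup>2 + b)\<^sup>2" unfolding on by (simp add: add.assoc char2_simps[OF ch])
  finally have l: "l\<^sup>2 + l = (x\<^sup>2 + b)\<^sup>2 / x\<^sup>2" using \<open>x \<noteq> 0\<close> by (simp add: field_simps)
  have three: "(3::'a) = 1" using char2_two[OF ch] by (metis numeral_Bit1 add_0 numeral_One one_add_one)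
  have ll: "(3 * x\<^sup>2 + 2 * 0 * x + b - 1 * y) / (2 * y + 1 * x + 0) = l"
    by (simp add: l_def three char2_simps[OF ch])
  have "w_add 1 0 0 b (Affine x y) (Affine x y) =
      Affine (l\<^sup>2 + l) (- (l + 1) * (l\<^sup>2 + l) - (y - l * x))"
    using \<open>x \<noteq> 0\<close> unfolding w_add.simps ll Let_def
    by (simp add: char2_simps[OF ch] ll)
  then show ?thesis using that unfolding l by blast
qed

text \<open>Negation replaces \<open>y2\<close> by \<open>y2 + x2\<close>, so the chords for sum and
  difference have slopes l and m = l + x2 / d, where d = x1 + x2. With K = x1 y2 + x2 y1 + d (x1 x2
  + b), the curve equations give s d^2 = K and t d^2 = K + x1 x2. Adding these gives the sum of the
  abscissas; in the product K (K + x1 x2) the ordinates cancel by the curve equations again.\<close>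

lemma w_add_distinct_x:
  fixes x1 x2 y1 y2 b :: "'a::field"
  assumes ch: "CHAR('a) = 2" and "x1 \<noteq> x2"
    and on1: "y1\<^sup>2 + x1 * y1 = x1 ^ 3 + b * x1" and on2: "y2\<^sup>2 + x2 * y2 = x2 ^ 3 + b * x2"
  obtains s zs t zt
  where "w_add 1 0 0 b (Affine x1 y1) (Affine x2 y2) = Affine s zs"
    and "w_add 1 0 0 b (Affine x1 y1) (w_neg 1 0 (Affine x2 y2)) = Affine t zt"
    and "(s + t) * (x1 + x2)\<^sup>2 = x1 * x2"
    and "s * t * (x1 + x2)\<^sup>2 = (x1 * x2 + b)\<^sup>2"
proof -
  note c2 = char2_simps[OF ch]
  define d where "d = x1 + x2"
  have d0: "d \<noteq> 0" using assms(2) by (simp add: d_def char2_add_eq_0_iff[OF ch])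
  define l where "l = (y1 + y2) / d"
  define m where "m = (y1 + y2 + x2) / d"
  define s where "s = l\<^sup>2 + l + x1 + x2"
  define t where "t = m\<^sup>2 + m + x1 + x2"
  have ld: "l * d = y1 + y2" and md: "m * d = y1 + y2 + x2" using d0 by (simp_all add: l_def m_def)
  have y1: "y1\<^sup>2 = x1 * y1 + (x1 ^ 3 + b * x1)" and y2: "y2\<^sup>2 = x2 * y2 + (x2 ^ 3 + b * x2)"
    unfolding on1[symmetric] on2[symmetric] by (simp_all add: c2 add_ac)
  have sd: "s * d\<^sup>2 = x1 * y2 + x2 * y1 + d * (x1 * x2 + b)"
  proof -
    have "s * d\<^sup>2 = (l * d)\<^sup>2 + (l * d) * d + d ^ 3"
      by (simp add: s_def d_def power2_eq_square power3_eq_cube algebra_simps)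
    also have "\<dots> = y1\<^sup>2 + y2\<^sup>2 + (y1 + y2) * d + d ^ 3"
      unfolding ld by (simp add: power2_eq_square algebra_simps c2)
    also have "\<dots> = x1 * y2 + x2 * y1 + d * (x1 * x2 + b)"
      unfolding y1 y2 d_def by (simp add: power2_eq_square power3_eq_cube algebra_simps c2)
    finally show ?thesis .
  qed
  have td: "t * d\<^sup>2 = x1 * y2 + x2 * y1 + d * (x1 * x2 + b) + x1 * x2"
  proof -
    have "t * d\<^sup>2 = (m * d)\<^sup>2 + (m * d) * d + d ^ 3"
      by (simp add: t_def d_def power2_eq_square power3_eq_cube algebra_simps)
    also have "\<dots> = y1\<^sup>2 + y2\<^sup>2 + (y1 + y2) * d + d ^ 3 + x1 * x2"
      unfolding md by (simp add: d_def power2_eq_square algebra_simps c2)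
    also have "\<dots> = x1 * y2 + x2 * y1 + d * (x1 * x2 + b) + x1 * x2"
      unfolding y1 y2 d_def by (simp add: power2_eq_square power3_eq_cube algebra_simps c2)
    finally show ?thesis .
  qed
  have 1: "(s + t) * d\<^sup>2 = x1 * x2"
    unfolding distrib_right sd td by (simp add: algebra_simps c2)
  have "(s * t * d\<^sup>2) * d\<^sup>2 = (s * d\<^sup>2) * (t * d\<^sup>2)" by (simp add: mult_ac)
  also have "\<dots> = x1\<^sup>2 * y2\<^sup>2 + x2\<^sup>2 * y1\<^sup>2 + d\<^sup>2 * (x1 * x2 + b)\<^sup>2
      + (x1 * y2 + x2 * y1 + d * (x1 * x2 + b)) * (x1 * x2)"
    unfolding sd td by (simp add: power2_eq_square algebra_simps c2)
  also have "\<dots> = (x1 * x2 + b)\<^sup>2 * d\<^sup>2"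
    unfolding y1 y2 d_def by (simp add: power2_eq_square power3_eq_cube algebra_simps c2)
  finally have 2: "s * t * d\<^sup>2 = (x1 * x2 + b)\<^sup>2" using d0 by simp
  obtain zs where 3: "w_add 1 0 0 b (Affine x1 y1) (Affine x2 y2) = Affine s zs"
    using assms(2) by (simp add: Let_def s_def l_def d_def c2 add_ac)
  obtain zt where 4: "w_add 1 0 0 b (Affine x1 y1) (w_neg 1 0 (Affine x2 y2)) = Affine t zt"
    using assms(2) by (simp add: Let_def t_def m_def d_def c2 add_ac)
  show ?thesis using that[OF 3 4] 1 2 unfolding d_def by blast
qed

lemma w_neg_in_Z4_model:
  fixes e :: "'a::field"
  assumes "q \<in> Z4_model e"
  shows "w_neg 1 0 q \<in> Z4_model e"
proof (cases q)
  case (Affine x y)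
  have "(- y - x)\<^sup>2 + x * (- y - x) = y\<^sup>2 + x * y" by (simp add: power2_eq_square algebra_simps)
  then show ?thesis using assms unfolding Affine by (simp add: w_points_def)
qed (simp add: w_points_def)

text \<open>The third relation follows from the first two unless \<open>Q\<close> and \<open>R\<close> have the same Kummer
  coordinate; in that case it becomes the doubling formula.\<close>

lemma kummer_relations:
  fixes e :: "'a::field"
  assumes ch: "CHAR('a) = 2" and e: "e \<noteq> 0"
    and p: "p \<in> Z4_model e" and q: "q \<in> Z4_model e"
    and U: "(U0, U1) \<in> kummer (from_model e p)" and V: "(V0, V1) \<in> kummer (from_model e q)"
    and s: "(s0, s1) \<in> kummer (from_model e (w_add 1 0 0 (1 / e\<^sup>2) p q))"
    and t: "(t0, t1) \<in> kummer (from_model e (w_add 1 0 0 (1 / e\<^sup>2) p (w_neg 1 0 q)))"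
  shows "s0 * t0 * (U0 * V1 + U1 * V0)\<^sup>2 = s1 * t1 * (U0 * V0 + U1 * V1)\<^sup>2 \<and>
    (s0 * t1 + s1 * t0) * (U0 * V1 + U1 * V0)\<^sup>2 = e * (s1 * t1) * (U0 * U1 * V0 * V1) \<and>
    (s0 * t1 + s1 * t0) * (U0 * V0 + U1 * V1)\<^sup>2 = e * (s0 * t0) * (U0 * U1 * V0 * V1)"
    (is "?R1 \<and> ?R2 \<and> ?R3")
proof -
  note c2 = char2_simps[OF ch]
  note mem = mem_kummer_from_model
  show ?thesis
  proof (cases p)
    case Infinity
    show ?thesis
    proof (cases q)
      case q: Infinity
      show ?thesis using U V s t unfolding Infinity q w_add.simps w_neg.simps mem by simp
    next
      case q: (Affine x y)
      show ?thesis using U V s t unfolding Infinity q w_add.simps w_neg.simps mem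
        by (simp add: power2_eq_square c2 algebra_simps)
    qed
  next
    case p': (Affine x1 y1)
    show ?thesis
    proof (cases q)
      case q: Infinity
      show ?thesis using U V s t unfolding p' q w_add.simps w_neg.simps mem
        by (simp add: power2_eq_square c2 algebra_simps)
    next
      case q': (Affine x2 y2)
      define b where "b = 1 / e\<^sup>2"
      have b: "b * e\<^sup>2 = 1" using e by (simp add: b_def)
      have on: "y1\<^sup>2 + x1 * y1 = x1 ^ 3 + b * x1" "y2\<^sup>2 + x2 * y2 = x2 ^ 3 + b * x2"
        using p q unfolding p' q' b_def w_points_def by simp_all
      have UV: "U0 = e * x1 * U1" "V0 = e * x2 * V1" using U V unfolding p' q' mem by auto
      show ?thesis
      proof (cases "x1 = x2")
        case False
        obtain xs zs xt zt where
          st: "w_add 1 0 0 b (Affine x1 y1) (Affine x2 y2) = Affine xs zs"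
            "w_add 1 0 0 b (Affine x1 y1) (w_neg 1 0 (Affine x2 y2)) = Affine xt zt"
          and sum: "(xs + xt) * (x1 + x2)\<^sup>2 = x1 * x2"
          and prod: "xs * xt * (x1 + x2)\<^sup>2 = (x1 * x2 + b)\<^sup>2"
          by (rule w_add_distinct_x[OF ch False on])
        have s0: "s0 = e * xs * s1" and t0: "t0 = e * xt * t1"
          using s t unfolding p' q' b_def[symmetric] st mem by auto
        have C: "U0 * V1 + U1 * V0 = e * (x1 + x2) * (U1 * V1)"
          unfolding UV by (simp add: algebra_simps)
        have D: "U0 * V0 + U1 * V1 = e\<^sup>2 * (x1 * x2 + b) * (U1 * V1)"
        proof -
          have "e\<^sup>2 * (x1 * x2 + b) * (U1 * V1) = (e\<^sup>2 * (x1 * x2) + b * e\<^sup>2) * (U1 * V1)"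
            by (simp add: algebra_simps)
          also have "\<dots> = U0 * V0 + U1 * V1"
            unfolding b UV by (simp add: power2_eq_square algebra_simps)
          finally show ?thesis by simp
        qed
        have AB: "U0 * U1 * V0 * V1 = e\<^sup>2 * (x1 * x2) * (U1 * V1)\<^sup>2"
          unfolding UV by (simp add: power2_eq_square algebra_simps)
        have s0t0: "s0 * t0 = e\<^sup>2 * (xs * xt) * (s1 * t1)"
          unfolding s0 t0 by (simp add: power2_eq_square algebra_simps)
        have st1: "s0 * t1 + s1 * t0 = e * (xs + xt) * (s1 * t1)"
          unfolding s0 t0 by (simp add: algebra_simps)
        have 1: ?R1 unfolding C D s0t0 power_mult_distrib prod[symmetric]
          by (simp add: power2_eq_square mult_ac)
        have 2: ?R2 unfolding C AB st1 power_mult_distrib sum[symmetric]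
          by (simp add: power2_eq_square mult_ac)
        have 3: ?R3 unfolding D AB s0t0 st1 power_mult_distrib prod[symmetric]
          unfolding sum[symmetric] by (simp add: power2_eq_square mult_ac)
        from 1 2 3 show ?thesis by blast
      next
        case True
        have C: "U0 * V1 + U1 * V0 = 0" unfolding UV True by (simp add: c2 mult_ac)
        have inf: "w_add 1 0 0 b (Affine x1 y1) (w_neg 1 0 (Affine x1 y1)) = Infinity"
          by (simp add: c2 add_ac)
        \<comment> \<open>One fact for both Q = R and Q = -R: \<open>r0\<close> is to be the nonzero
          coordinate of whichever of Q - R and Q + R is the neutral element, and
          \<open>(w0, w1)\<close> represents the other one, which is 2Q.\<close>
        have dbl: ?R3 if x: "x1 \<noteq> 0" and "s0 * t1 + s1 * t0 = r0 * w1" "s0 * t0 = r0 * w0"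
            "(w0, w1) \<in> kummer (from_model e (w_add 1 0 0 b (Affine x1 y1) (Affine x1 y1)))"
          for r0 w0 w1 :: 'a
        proof -
          obtain z where z: "w_add 1 0 0 b (Affine x1 y1) (Affine x1 y1) =
              Affine ((x1\<^sup>2 + b)\<^sup>2 / x1\<^sup>2) z"
            by (rule w_add_double_x[OF ch x on(1)])
          have w0: "w0 = e * ((x1\<^sup>2 + b)\<^sup>2 / x1\<^sup>2) * w1" using that(4) unfolding z mem by blast
          then have w0x: "w0 * x1\<^sup>2 = e * (x1\<^sup>2 + b)\<^sup>2 * w1" using x by simp
          have D: "U0 * V0 + U1 * V1 = e\<^sup>2 * (x1\<^sup>2 + b) * (U1 * V1)"
          proof -
            have "e\<^sup>2 * (x1\<^sup>2 + b) * (U1 * V1) = (e\<^sup>2 * x1\<^sup>2 + b * e\<^sup>2) * (U1 * V1)"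
              by (simp add: algebra_simps)
            also have "\<dots> = U0 * V0 + U1 * V1"
              unfolding b UV True by (simp add: power2_eq_square algebra_simps)
            finally show ?thesis by simp
          qed
          have AB: "U0 * U1 * V0 * V1 = e\<^sup>2 * x1\<^sup>2 * (U1 * V1)\<^sup>2"
            unfolding UV True by (simp add: power2_eq_square algebra_simps)
          have "e * (r0 * w0) * (e\<^sup>2 * x1\<^sup>2 * (U1 * V1)\<^sup>2) = e * r0 * e\<^sup>2 * (w0 * x1\<^sup>2) * (U1 * V1)\<^sup>2"
            by (simp add: mult_ac)
          also have "\<dots> = r0 * w1 * (e\<^sup>2 * (x1\<^sup>2 + b) * (U1 * V1))\<^sup>2"
            unfolding w0x by (simp add: power2_eq_square mult_ac)
          finally show ?thesis unfolding D AB that(2,3) by (rule sym)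
        qed
        \<comment> \<open>Equal abscissas force Q = R or Q = -R, because the difference of the two
          curve equations factors.\<close>
        have "(y2 - y1) * (y2 + y1 + x1) = (y2\<^sup>2 + x2 * y2) - (y1\<^sup>2 + x1 * y1)"
          unfolding True by (simp add: power2_eq_square algebra_simps)
        also have "\<dots> = 0" unfolding on unfolding True by simp
        finally consider "y2 = y1" | "y2 + y1 + x1 = 0" by auto
        then show ?thesis
        proof cases
          case 1
          have t': "t0 \<noteq> 0" "t1 = 0"
            using t unfolding p' q' b_def[symmetric] 1 True[symmetric] inf mem by auto
          have s': "(s0, s1) \<in> kummer (from_model e (w_add 1 0 0 b (Affine x1 y1) (Affine x1 y1)))"
            using s unfolding p' q' b_def[symmetric] 1 True[symmetric] .
          have ?R3
          proof (cases "x1 = 0")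
            case False
            show ?thesis by (rule dbl[where ?r0.0 = t0, OF False _ _ s'])
              (use t' in \<open>simp_all add: mult_ac\<close>)
          next
            \<comment> \<open>Here Q has order two, so sum and difference are both neutral and
              \<open>s1 = t1 = 0\<close>. Since also \<open>U0 = 0\<close>, both sides of the third
              relation vanish.\<close>
            case x: True
            have "w_add 1 0 0 b (Affine x1 y1) (Affine x1 y1) = Infinity" by (simp add: x c2)
            then have "s1 = 0" using s' mem(1) by metis
            then show ?thesis using t' UV x by simp
          qed
          then show ?thesis using t' C by simp
        next
          case 2
          have n: "w_neg 1 0 (Affine x2 y2) = Affine x1 y1"
            using 2 True by (simp add: c2) (metis ch char2_add_eq_0_iff add.assoc add.commute)
          have "w_add 1 0 0 b (Affine x1 y1) (Affine x2 y2) = Infinity"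
            using 2 True by (simp add: add_ac)
          then have s': "s0 \<noteq> 0" "s1 = 0"
            using s unfolding p' q' b_def[symmetric] by (metis mem(1))+
          have t': "(t0, t1) \<in> kummer (from_model e (w_add 1 0 0 b (Affine x1 y1) (Affine x1 y1)))"
            using t unfolding p' q' b_def[symmetric] n .
          have ?R3
          proof (cases "x1 = 0")
            case False
            show ?thesis by (rule dbl[where ?r0.0 = s0, OF False _ _ t'])
              (use s' in \<open>simp_all add: mult_ac\<close>)
          next
            case x: True
            have "w_add 1 0 0 b (Affine x1 y1) (Affine x1 y1) = Infinity" by (simp add: x c2)
            then have "t1 = 0" using t' mem(1) by metis
            then show ?thesis using s' UV x by simp
          qed
          then show ?thesis using s' C by simp
        qed
      qed
    qed
  qed
qed


section \<open>Coordinates of the double and of the sum\<close>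

lemma to_model_from_model:
  fixes e :: "'a::field"
  assumes "CHAR('a) = 2" "e \<noteq> 0" "p \<in> Z4_model e"
  shows "to_model e (from_model e p) = p"
  unfolding to_model_def using inj_on_from_model[OF assms(1,2)] assms(3) by (rule inv_into_f_f)

text \<open>Moves a pair of \<open>Delta\<close> to the Weierstrass model once and for all, so that
  later arguments never meet \<open>to_model\<close>.\<close>

lemma Delta_model:
  fixes e :: "'a::field"
  assumes ch: "CHAR('a) = 2" and e: "e \<noteq> 0" and QR: "(Q, R) \<in> Delta e P"
  obtains p q where "p \<in> Z4_model e" "q \<in> Z4_model e" "Q = from_model e p" "R = from_model e q"
    "Z4_add e Q Q = from_model e (w_add 1 0 0 (1 / e\<^sup>2) p p)"
    "Z4_add e Q R = from_model e (w_add 1 0 0 (1 / e\<^sup>2) p q)"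
    "P = from_model e (w_add 1 0 0 (1 / e\<^sup>2) p (w_neg 1 0 q))"
proof -
  note tm = to_model_from_model[OF ch e]
  have Q: "Q \<in> Z4_points e" and R: "R \<in> Z4_points e" and P: "P = Z4_add e Q (Z4_neg e R)"
    using QR by (auto simp: Delta_def)
  obtain p where p: "p \<in> Z4_model e" "Q = from_model e p" using from_model_surj[OF ch e Q] by blast
  obtain q where q: "q \<in> Z4_model e" "R = from_model e q" using from_model_surj[OF ch e R] by blast
  show ?thesis
    by (rule that[OF p(1) q(1) p(2) q(2)])
      (simp_all only: P p(2) q(2) Z4_add_def Z4_neg_def tm[OF p(1)] tm[OF q(1)]
        tm[OF w_neg_in_Z4_model[OF q(1)]])
qed

text \<open>Doubling is the case R = Q of the third biquadratic relation: the difference is then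
  neutral, with coordinates (1, 0), and the first two relations become trivial.\<close>

lemma double_coordinates:
  fixes e :: "'a::field"
  assumes ch: "CHAR('a) = 2" and e: "e \<noteq> 0" and QR: "(Q, R) \<in> Delta e P"
    and U: "(U0, U1) \<in> kummer Q"
  shows "((U0 + U1) ^ 4, e * (U0 * U1)\<^sup>2) \<in> kummer (Z4_add e Q Q)"
proof -
  obtain p where p: "p \<in> Z4_model e" "Q = from_model e p"
    and d: "Z4_add e Q Q = from_model e (w_add 1 0 0 (1 / e\<^sup>2) p p)"
    by (rule Delta_model[OF ch e QR])
  obtain s0 s1 where s: "(s0, s1) \<in> kummer (from_model e (w_add 1 0 0 (1 / e\<^sup>2) p p))"
    by (rule ex_mem_kummer_from_model)
  have "w_add 1 0 0 (1 / e\<^sup>2) p (w_neg 1 0 p) = Infinity"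
    by (cases p) (simp_all add: char2_simps[OF ch] add_ac)
  then have t: "(1, 0) \<in> kummer (from_model e (w_add 1 0 0 (1 / e\<^sup>2) p (w_neg 1 0 p)))"
    by (simp only: mem_kummer_from_model, simp)
  have "s1 * (U0 * U0 + U1 * U1)\<^sup>2 = e * s0 * (U0 * U1 * U0 * U1)"
    using kummer_relations[OF ch e p(1,1) U[unfolded p(2)] U[unfolded p(2)] s t] by simp
  moreover have "(U0 * U0 + U1 * U1)\<^sup>2 = (U0 + U1) ^ 4"
    by (simp add: power4_eq_xxxx power2_eq_square algebra_simps char2_simps[OF ch])
  ultimately have "(U0 + U1) ^ 4 * s1 = e * (U0 * U1)\<^sup>2 * s0"
    by (simp add: power2_eq_square mult_ac)
  moreover have "((U0 + U1) ^ 4, e * (U0 * U1)\<^sup>2) \<noteq> (0, 0)"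
    using mem_kummer_nonzero[OF U] e by auto
  ultimately show ?thesis
    unfolding d kummer_from_model_eq_proj1[OF s]
    by (simp only: mem_proj1_iff[OF mem_kummer_nonzero[OF s]] simp_thms)
qed

lemma sum_relations:
  fixes e :: "'a::field"
  assumes ch: "CHAR('a) = 2" and e: "e \<noteq> 0" and QR: "(Q, R) \<in> Delta e P"
    and U: "(U0, U1) \<in> kummer Q" and V: "(V0, V1) \<in> kummer R" and t: "(t0, t1) \<in> kummer P"
  obtains s0 s1 where "(s0, s1) \<noteq> (0, 0)"
    and "s0 * t0 * (U0 * V1 + U1 * V0)\<^sup>2 = s1 * t1 * (U0 * V0 + U1 * V1)\<^sup>2"
    and "(s0 * t1 + s1 * t0) * (U0 * V1 + U1 * V0)\<^sup>2 = e * (s1 * t1) * (U0 * U1 * V0 * V1)"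
    and "(s0 * t1 + s1 * t0) * (U0 * V0 + U1 * V1)\<^sup>2 = e * (s0 * t0) * (U0 * U1 * V0 * V1)"
    and "kummer (Z4_add e Q R) = proj1 s0 s1"
proof -
  obtain p q where pq: "p \<in> Z4_model e" "q \<in> Z4_model e" "Q = from_model e p" "R = from_model e q"
    and d: "Z4_add e Q R = from_model e (w_add 1 0 0 (1 / e\<^sup>2) p q)"
      "P = from_model e (w_add 1 0 0 (1 / e\<^sup>2) p (w_neg 1 0 q))"
    by (rule Delta_model[OF ch e QR])
  obtain s0 s1 where s: "(s0, s1) \<in> kummer (from_model e (w_add 1 0 0 (1 / e\<^sup>2) p q))"
    by (rule ex_mem_kummer_from_model)
  show ?thesis
  proof (rule that)
    show "(s0, s1) \<noteq> (0, 0)" using s by (rule mem_kummer_nonzero)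
    show "kummer (Z4_add e Q R) = proj1 s0 s1"
      unfolding d(1) using s by (rule kummer_from_model_eq_proj1)
  qed (use kummer_relations[OF ch e pq(1,2) U[unfolded pq(3)] V[unfolded pq(4)] s t[unfolded d(2)]]
      in blast)+
qed

text \<open>The first relation is exactly the required cross-multiplication. The other two serve to
  show that the outputs are not both zero.\<close>

lemma sum_coordinates_generic:
  fixes e :: "'a::field"
  assumes ch: "CHAR('a) = 2" and e: "e \<noteq> 0" and QR: "(Q, R) \<in> Delta e P"
    and U: "(U0, U1) \<in> kummer Q" and V: "(V0, V1) \<in> kummer R" and t: "(t0, t1) \<in> kummer P"
    and "t0 \<noteq> 0" "t1 \<noteq> 0"
  shows "(t1 * (U0 * V0 + U1 * V1)\<^sup>2, t0 * (U0 * V1 + U1 * V0)\<^sup>2) \<in> kummer (Z4_add e Q R)"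
proof -
  obtain s0 s1 where s: "(s0, s1) \<noteq> (0, 0)"
    and r1: "s0 * t0 * (U0 * V1 + U1 * V0)\<^sup>2 = s1 * t1 * (U0 * V0 + U1 * V1)\<^sup>2"
    and r2: "(s0 * t1 + s1 * t0) * (U0 * V1 + U1 * V0)\<^sup>2 = e * (s1 * t1) * (U0 * U1 * V0 * V1)"
    and r3: "(s0 * t1 + s1 * t0) * (U0 * V0 + U1 * V1)\<^sup>2 = e * (s0 * t0) * (U0 * U1 * V0 * V1)"
    and S: "kummer (Z4_add e Q R) = proj1 s0 s1"
    by (rule sum_relations[OF ch e QR U V t])
  show ?thesis
    unfolding S mem_proj1_iff[OF s]
  proof
    show "t1 * (U0 * V0 + U1 * V1)\<^sup>2 * s1 = t0 * (U0 * V1 + U1 * V0)\<^sup>2 * s0"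
      using r1 by (simp add: mult_ac)
    show "(t1 * (U0 * V0 + U1 * V1)\<^sup>2, t0 * (U0 * V1 + U1 * V0)\<^sup>2) \<noteq> (0, 0)"
    proof
      assume "(t1 * (U0 * V0 + U1 * V1)\<^sup>2, t0 * (U0 * V1 + U1 * V0)\<^sup>2) = (0, 0)"
      then have 0: "U0 * V0 + U1 * V1 = 0" "U0 * V1 + U1 * V0 = 0"
        using assms(7,8) by auto
      then have "s0 * (U0 * U1 * V0 * V1) = 0" "s1 * (U0 * U1 * V0 * V1) = 0"
        using r2 r3 assms(7,8) e by auto
      then have "U0 * U1 * V0 * V1 = 0" using s by auto
      \<comment> \<open>Some coordinate is zero, say \<open>U0\<close>. Then \<open>U1 * V1\<close>
        and \<open>U1 * V0\<close> vanish by \<open>0\<close>, so one of the input pairs would be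
        (0, 0).\<close>
      then show False using 0 mem_kummer_nonzero[OF U] mem_kummer_nonzero[OF V] by auto
    qed
  qed
qed

text \<open>Solves the third relation for \<open>s0 : s1\<close>. Unlike the product formula it
  stays valid for \<open>t1 = 0\<close>.\<close>

lemma sum_coordinates_fst:
  fixes e :: "'a::field"
  assumes ch: "CHAR('a) = 2" and e: "e \<noteq> 0" and QR: "(Q, R) \<in> Delta e P"
    and U: "(U0, U1) \<in> kummer Q" and V: "(V0, V1) \<in> kummer R" and t: "(1, t1) \<in> kummer P"
  shows "((U0 * V0 + U1 * V1)\<^sup>2,
      e * (U0 * V0 * (U1 * V1)) + t1 * (U0 * V0 + U1 * V1)\<^sup>2) \<in> kummer (Z4_add e Q R)"
    (is "(?D, ?N) \<in> _")
proof -
  obtain s0 s1 where s: "(s0, s1) \<noteq> (0, 0)"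
    and r1: "s0 * (U0 * V1 + U1 * V0)\<^sup>2 = s1 * t1 * (U0 * V0 + U1 * V1)\<^sup>2"
    and r2: "(s0 * t1 + s1) * (U0 * V1 + U1 * V0)\<^sup>2 = e * (s1 * t1) * (U0 * U1 * V0 * V1)"
    and r3: "(s0 * t1 + s1) * (U0 * V0 + U1 * V1)\<^sup>2 = e * s0 * (U0 * U1 * V0 * V1)"
    and S: "kummer (Z4_add e Q R) = proj1 s0 s1"
    by (rule sum_relations[OF ch e QR U V t, unfolded mult_1_right mult_zero_left
      mult_zero_right add_0_left add_0_right])
  show ?thesis
    unfolding S mem_proj1_iff[OF s]
  proof
    have "?N * s0 = e * s0 * (U0 * U1 * V0 * V1) + s0 * t1 * ?D" by (simp add: algebra_simps)
    also have "\<dots> = ?D * s1 + (s0 * t1 * ?D + s0 * t1 * ?D)"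
      unfolding r3[symmetric] by (simp add: algebra_simps)
    finally show "?D * s1 = ?N * s0" by (simp add: char2_add_self[OF ch])
    show "(?D, ?N) \<noteq> (0, 0)"
    proof
      assume "(?D, ?N) = (0, 0)"
      \<comment> \<open>\<open>?D\<close> gives A + B = 0, which removes the \<open>t1\<close> term
        of \<open>?N\<close> and leaves A B = 0. Hence A = B = 0.\<close>
      then have 0: "U0 * V0 = 0" "U1 * V1 = 0" using e by auto
      then have AB: "U0 * U1 * V0 * V1 = 0" by auto
      have "U0 * V1 + U1 * V0 \<noteq> 0"
        using 0 mem_kummer_nonzero[OF U] mem_kummer_nonzero[OF V] by auto
      then have "s0 = 0" "s1 = 0" using 0 r1 r2 AB by auto
      then show False using s by simp
    qed
  qed
qed

text \<open>Solves the second relation instead. The product is grouped so that the formula is the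
  previous one with \<open>V0\<close> and \<open>V1\<close> exchanged and the outputs swapped, which
  lets one code scheme serve both.\<close>

lemma sum_coordinates_snd:
  fixes e :: "'a::field"
  assumes ch: "CHAR('a) = 2" and e: "e \<noteq> 0" and QR: "(Q, R) \<in> Delta e P"
    and U: "(U0, U1) \<in> kummer Q" and V: "(V0, V1) \<in> kummer R" and t: "(t0, 1) \<in> kummer P"
  shows "(e * (U0 * V1 * (U1 * V0)) + t0 * (U0 * V1 + U1 * V0)\<^sup>2,
      (U0 * V1 + U1 * V0)\<^sup>2) \<in> kummer (Z4_add e Q R)"
    (is "(?N, ?D) \<in> _")
proof -
  obtain s0 s1 where s: "(s0, s1) \<noteq> (0, 0)"
    and r1: "s0 * t0 * (U0 * V1 + U1 * V0)\<^sup>2 = s1 * (U0 * V0 + U1 * V1)\<^sup>2"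
    and r2: "(s0 + s1 * t0) * (U0 * V1 + U1 * V0)\<^sup>2 = e * s1 * (U0 * U1 * V0 * V1)"
    and r3: "(s0 + s1 * t0) * (U0 * V0 + U1 * V1)\<^sup>2 = e * (s0 * t0) * (U0 * U1 * V0 * V1)"
    and S: "kummer (Z4_add e Q R) = proj1 s0 s1"
    by (rule sum_relations[OF ch e QR U V t, unfolded mult_1_right mult_zero_left
      mult_zero_right add_0_left add_0_right])
  show ?thesis
    unfolding S mem_proj1_iff[OF s]
  proof
    have "?N * s1 = e * s1 * (U0 * U1 * V0 * V1) + s1 * t0 * ?D" by (simp add: algebra_simps)
    also have "\<dots> = ?D * s0 + (s1 * t0 * ?D + s1 * t0 * ?D)"
      unfolding r2[symmetric] by (simp add: algebra_simps)
    finally show "?N * s1 = ?D * s0" by (simp add: char2_add_self[OF ch])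
    show "(?N, ?D) \<noteq> (0, 0)"
    proof
      assume "(?N, ?D) = (0, 0)"
      then have 0: "U0 * V1 = 0" "U1 * V0 = 0" using e by auto
      then have AB: "U0 * U1 * V0 * V1 = 0" by auto
      have "U0 * V0 + U1 * V1 \<noteq> 0"
        using 0 mem_kummer_nonzero[OF U] mem_kummer_nonzero[OF V] by auto
      then have "s0 = 0" "s1 = 0" using 0 r1 r3 AB by auto
      then show False using s by simp
    qed
  qed
qed

text \<open>For \<open>P\<close> one of the two points \<open>Z4_O\<close> and \<open>(0:1:1:0)\<close> of order at most two, \<open>V\<close> is
  determined by \<open>U\<close> and \<open>sum_coordinates_generic\<close> degenerates, but \<open>Q + R\<close> is \<open>2Q\<close> up to
  translation by \<open>P\<close>, which swaps the coordinates if \<open>P = (0:1:1:0)\<close>.\<close>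

lemma sum_coordinates_O:
  fixes e :: "'a::field"
  assumes ch: "CHAR('a) = 2" and e: "e \<noteq> 0" and QR: "(Q, R) \<in> Delta e P"
    and U: "(U0, U1) \<in> kummer Q" and V: "(V0, V1) \<in> kummer R" and t: "(1, 0) \<in> kummer P"
  shows "((U0 + U1) ^ 4, e * (U0 * U1)\<^sup>2) \<in> kummer (Z4_add e Q R)"
proof -
  note nz = mem_kummer_nonzero[OF U] mem_kummer_nonzero[OF V]
  obtain s0 s1 where s: "(s0, s1) \<noteq> (0, 0)"
    and r1: "s0 * (U0 * V1 + U1 * V0)\<^sup>2 = 0"
    and r2: "s1 * (U0 * V1 + U1 * V0)\<^sup>2 = 0"
    and r3: "s1 * (U0 * V0 + U1 * V1)\<^sup>2 = e * s0 * (U0 * U1 * V0 * V1)"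
    and S: "kummer (Z4_add e Q R) = proj1 s0 s1"
    by (rule sum_relations[OF ch e QR U V t, unfolded mult_1_right mult_zero_left
      mult_zero_right add_0_left add_0_right])
  \<comment> \<open>Both \<open>s0\<close> and \<open>s1\<close> annihilate the square and one of
    them is nonzero. So V is proportional to U, as expected for Q = R.\<close>
  have "U0 * V1 + U1 * V0 = 0" using s r1 r2 by auto
  then have "V0 * U1 = V1 * U0" by (simp add: char2_add_eq_0_iff[OF ch] mult_ac)
  then have "(V0, V1) \<in> proj1 U0 U1" using nz by (simp add: mem_proj1_iff)
  then obtain l where l: "l \<noteq> 0" "V0 = l * U0" "V1 = l * U1" by (auto simp: proj1_def)
  show ?thesis
    unfolding S mem_proj1_iff[OF s]
  proof
    have "l\<^sup>2 * ((U0 + U1) ^ 4 * s1) = s1 * (U0 * V0 + U1 * V1)\<^sup>2"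
      unfolding l by (simp add: power4_eq_xxxx power2_eq_square algebra_simps char2_simps[OF ch])
    also have "\<dots> = l\<^sup>2 * (e * (U0 * U1)\<^sup>2 * s0)"
      unfolding r3 unfolding l by (simp add: power2_eq_square mult_ac)
    finally show "(U0 + U1) ^ 4 * s1 = e * (U0 * U1)\<^sup>2 * s0" using l(1) by simp
    show "((U0 + U1) ^ 4, e * (U0 * U1)\<^sup>2) \<noteq> (0, 0)" using nz e by auto
  qed
qed

lemma sum_coordinates_T:
  fixes e :: "'a::field"
  assumes ch: "CHAR('a) = 2" and e: "e \<noteq> 0" and QR: "(Q, R) \<in> Delta e P"
    and U: "(U0, U1) \<in> kummer Q" and V: "(V0, V1) \<in> kummer R" and t: "(0, 1) \<in> kummer P"
  shows "(e * (U0 * U1)\<^sup>2, (U0 + U1) ^ 4) \<in> kummer (Z4_add e Q R)"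
proof -
  note nz = mem_kummer_nonzero[OF U] mem_kummer_nonzero[OF V]
  obtain s0 s1 where s: "(s0, s1) \<noteq> (0, 0)"
    and r1: "0 = s1 * (U0 * V0 + U1 * V1)\<^sup>2"
    and r2: "s0 * (U0 * V1 + U1 * V0)\<^sup>2 = e * s1 * (U0 * U1 * V0 * V1)"
    and r3: "s0 * (U0 * V0 + U1 * V1)\<^sup>2 = 0"
    and S: "kummer (Z4_add e Q R) = proj1 s0 s1"
    by (rule sum_relations[OF ch e QR U V t, unfolded mult_1_right mult_zero_left
      mult_zero_right add_0_left add_0_right])
  \<comment> \<open>The same argument now makes V proportional to U with its coordinates swapped,
    the effect of translation by (0:1:1:0).\<close>
  have "U0 * V0 + U1 * V1 = 0" using s r1 r3 by auto
  then have "V0 * U0 = V1 * U1" by (simp add: char2_add_eq_0_iff[OF ch] mult_ac)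
  then have "(V0, V1) \<in> proj1 U1 U0" using nz by (subst mem_proj1_iff) auto
  then obtain l where l: "l \<noteq> 0" "V0 = l * U1" "V1 = l * U0" by (auto simp: proj1_def)
  show ?thesis
    unfolding S mem_proj1_iff[OF s]
  proof
    have "l\<^sup>2 * ((U0 + U1) ^ 4 * s0) = s0 * (U0 * V1 + U1 * V0)\<^sup>2"
      unfolding l by (simp add: power4_eq_xxxx power2_eq_square algebra_simps char2_simps[OF ch])
    also have "\<dots> = l\<^sup>2 * (e * (U0 * U1)\<^sup>2 * s1)"
      unfolding r2 unfolding l by (simp add: power2_eq_square mult_ac)
    finally show "e * (U0 * U1)\<^sup>2 * s1 = (U0 + U1) ^ 4 * s0" using l(1) by simp
    show "(e * (U0 * U1)\<^sup>2, (U0 + U1) ^ 4) \<noteq> (0, 0)" using nz e by auto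
  qed
qed


section \<open>The programs\<close>

lemma computes_montgomeryI:
  assumes "wf_program (Program is (o0, o1, o2, o3))"
    and "\<And>Q R U0 U1 V0 V1 v. (Q, R) \<in> Delta (to_ac (c\<^sup>2)) P \<Longrightarrow> (U0, U1) \<in> kummer Q \<Longrightarrow>
      (V0, V1) \<in> kummer R \<Longrightarrow> v = run c [U0, U1, V0, V1] is \<Longrightarrow>
      (v ! o0, v ! o1) \<in> kummer (Z4_add (to_ac (c\<^sup>2)) Q Q) \<and>
      (v ! o2, v ! o3) \<in> kummer (Z4_add (to_ac (c\<^sup>2)) Q R)"
  shows "computes_montgomery c P (Program is (o0, o1, o2, o3))"
  unfolding computes_montgomery_def
proof (intro conjI ballI, goal_cases)
  case 1
  show ?case by (rule assms(1))
next
  case (2 z)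
  then obtain Q R where QR: "(Q, R) \<in> Delta (to_ac (c\<^sup>2)) P"
    and z: "z = ((kummer Q, kummer R),
      (kummer (Z4_add (to_ac (c\<^sup>2)) Q Q), kummer (Z4_add (to_ac (c\<^sup>2)) Q R)))"
    unfolding montgomery_def by auto
  show ?case unfolding z using assms(2)[OF QR _ _ refl] by (auto simp: Let_def)
qed

text \<open>The doubling leaves \<open>U\<^sub>0 + U\<^sub>1\<close> at position 4 and the coordinates of \<open>2Q\<close> at 6 and 9.\<close>

definition double_code :: "'a instr list"
  where "double_code = [Add 0 1, Sqr 4, Sqr 5, Mul 0 1, MulC 1 7, Sqr 8]"

text \<open>The cross term C comes from Karatsuba's trick, reusing \<open>U0 + U1\<close> at
  position 4. The squares of A + B and C stand at 16 and 17; \<open>j\<close> selects the one to be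
  scaled, since the normalization makes the other factor 1.\<close>

definition generic_code :: "'a \<Rightarrow> nat \<Rightarrow> 'a instr list"
  where "generic_code t j = double_code @
    [Mul 0 2, Mul 1 3, Add 10 11, Add 2 3, Mul 4 13, Add 14 12, Sqr 12, Sqr 15, MulT t j]"

text \<open>\<open>i\<close> and \<open>j\<close> are the positions of \<open>V0\<close> and
  \<open>V1\<close> in either order: 2, 3 for \<open>t0 = 1\<close> and 3, 2 for
  \<open>t1 = 1\<close>.\<close>

definition unified_code :: "'a \<Rightarrow> nat \<Rightarrow> nat \<Rightarrow> 'a instr list"
  where "unified_code t i j = double_code @
    [Mul 0 i, Mul 1 j, Add 10 11, Sqr 12, Mul 10 11, MulC 2 14, MulT t 13, Add 15 16]"

lemma run_double_code:
  fixes c :: "'a::field"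
  shows "run c [U0, U1, V0, V1] double_code =
    [U0, U1, V0, V1, U0 + U1, (U0 + U1)\<^sup>2, (U0 + U1) ^ 4, U0 * U1, to_ac c * (U0 * U1),
     to_ac (c\<^sup>2) * (U0 * U1)\<^sup>2]"
  by (simp add: run_def double_code_def nth_Cons' power_mult_distrib flip: power_mult)

lemma run_append: "run c xs (is @ js) = run c (run c xs is) js"
  by (simp add: run_def)

lemma run_Nil: "run c xs [] = xs"
  by (simp add: run_def)

lemma run_Cons: "run c xs (i # is) = run c (xs @ [value_of c xs i]) is"
  by (simp add: run_def)

lemma run_generic_code:
  fixes c t :: "'a::field"
  assumes ch: "CHAR('a) = 2" and j: "j = 16 \<or> j = 17"
  shows "let v = run c [U0, U1, V0, V1] (generic_code t j) in
    v ! 6 = (U0 + U1) ^ 4 \<and> v ! 9 = to_ac (c\<^sup>2) * (U0 * U1)\<^sup>2 \<and>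
    v ! 16 = (U0 * V0 + U1 * V1)\<^sup>2 \<and> v ! 17 = (U0 * V1 + U1 * V0)\<^sup>2 \<and> v ! 18 = to_ac t * v ! j"
proof -
  have ch': "CHAR('a alg_closure) = 2" using ch by simp
  have C: "(U0 + U1) * (V0 + V1) + (U0 * V0 + U1 * V1) = U0 * V1 + U1 * V0"
    by (simp add: algebra_simps char2_simps[OF ch'])
  show ?thesis
    unfolding generic_code_def run_append run_double_code
    by (rule disjE[OF j]; simp only: run_Cons; simp add: run_Nil C)
qed

lemma run_unified_code:
  fixes c t :: "'a::field"
  shows "let v = run c [U0, U1, V0, V1] (unified_code t 2 3) in
    v ! 6 = (U0 + U1) ^ 4 \<and> v ! 9 = to_ac (c\<^sup>2) * (U0 * U1)\<^sup>2 \<and>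
    v ! 13 = (U0 * V0 + U1 * V1)\<^sup>2 \<and>
    v ! 17 = to_ac (c\<^sup>2) * (U0 * V0 * (U1 * V1)) + to_ac t * (U0 * V0 + U1 * V1)\<^sup>2"
    and "let v = run c [U0, U1, V0, V1] (unified_code t 3 2) in
    v ! 6 = (U0 + U1) ^ 4 \<and> v ! 9 = to_ac (c\<^sup>2) * (U0 * U1)\<^sup>2 \<and>
    v ! 13 = (U0 * V1 + U1 * V0)\<^sup>2 \<and>
    v ! 17 = to_ac (c\<^sup>2) * (U0 * V1 * (U1 * V0)) + to_ac t * (U0 * V1 + U1 * V0)\<^sup>2"
  unfolding unified_code_def run_append run_double_code
  by (simp_all only: run_Cons, simp_all add: run_Nil)

lemmas wf_code = double_code_def generic_code_def unified_code_def All_less_Suc nth_Cons'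

theorem corollary26:
  fixes c t0 t1 t2 t3 :: "'a::field"
  assumes char2: "CHAR('a) = 2"
    and ell: "elliptic_Z4 (c\<^sup>2)"
    and P_on_E: "on_Z4 (c\<^sup>2) t0 t1 t2 t3"
    and normalized: "t0 = 1 \<or> t1 = 1"
  shows "(\<exists>p. computes_montgomery c (proj3 (to_ac t0) (to_ac t1) (to_ac t2) (to_ac t3)) p \<and>
              cost_at_most p 4 5 1 1) \<and>
         (\<exists>p. computes_montgomery c (proj3 (to_ac t0) (to_ac t1) (to_ac t2) (to_ac t3)) p \<and>
              cost_at_most p 4 4 1 2)"
proof -
  define P where "P = proj3 (to_ac t0) (to_ac t1) (to_ac t2) (to_ac t3)"
  define e where "e = to_ac (c\<^sup>2)"
  have ch: "CHAR('a alg_closure) = 2" using char2 by simp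
  have e: "e \<noteq> 0" using ell elliptic_Z4_iff[OF char2] by (simp add: e_def)
  have "(to_ac t0, to_ac t1, to_ac t2, to_ac t3) \<in> P"
    unfolding P_def proj3_def by (auto intro: exI[of _ 1])
  then have t: "(to_ac t0, to_ac t1) \<in> kummer P" using normalized by (auto simp: kummer_def)
  note dbl = double_coordinates[OF ch e]
  have "\<exists>p. computes_montgomery c P p \<and> cost_at_most p 4 5 1 1"
  proof -
    \<comment> \<open>The product formula requires both coordinates of P to be nonzero. The two
      excluded cases are those of \<open>sum_coordinates_O\<close> and
      \<open>sum_coordinates_T\<close>.\<close>
    consider "t1 = 0" "t0 = 1" | "t0 = 0" "t1 = 1" | "t0 = 1" "t1 \<noteq> 0" | "t1 = 1" "t0 \<noteq> 0"
      using normalized by auto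
    then show ?thesis
    proof cases
      case 1
      \<comment> \<open>For neutral P the sum has the coordinates of the double, so the same
        positions are output twice.\<close>
      have "computes_montgomery c P (Program double_code (6, 9, 6, 9))"
        (is "computes_montgomery c P ?p")
      proof (rule computes_montgomeryI, goal_cases)
        case (2 Q R U0 U1 V0 V1 v)
        have "(1, 0) \<in> kummer P" using t 1 by simp
        from dbl[OF _ 2(2)] sum_coordinates_O[OF ch e 2(1)[folded e_def] 2(2,3) this]
        show ?case using 2(1) unfolding 2(4) run_double_code e_def[symmetric] by simp
      qed (simp add: wf_code)
      moreover have "cost_at_most ?p 4 5 1 1"
        by (simp add: cost_at_most_def double_code_def)
      ultimately show ?thesis by blast
    next
      case 2
      have "computes_montgomery c P (Program double_code (6, 9, 9, 6))"
        (is "computes_montgomery c P ?p")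
      proof (rule computes_montgomeryI, goal_cases)
        case (2 Q R U0 U1 V0 V1 v)
        have "(0, 1) \<in> kummer P" using t \<open>t0 = 0\<close> \<open>t1 = 1\<close> by simp
        from dbl[OF _ 2(2)] sum_coordinates_T[OF ch e 2(1)[folded e_def] 2(2,3) this]
        show ?case using 2(1) unfolding 2(4) run_double_code e_def[symmetric] by simp
      qed (simp add: wf_code)
      moreover have "cost_at_most ?p 4 5 1 1"
        by (simp add: cost_at_most_def double_code_def)
      ultimately show ?thesis by blast
    next
      case 3
      have "computes_montgomery c P (Program (generic_code t1 16) (6, 9, 18, 17))"
        (is "computes_montgomery c P ?p")
      proof (rule computes_montgomeryI, goal_cases)
        case (2 Q R U0 U1 V0 V1 v)
        note QR = 2(1)[folded e_def]
        show ?case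
          using run_generic_code[OF char2, of 16 c U0 U1 V0 V1 t1] dbl[OF QR 2(2)] 3
            sum_coordinates_generic[OF ch e QR 2(2,3) t]
          unfolding 2(4)[symmetric] e_def[symmetric] by (simp add: Let_def)
      qed (simp add: wf_code)
      moreover have "cost_at_most ?p 4 5 1 1"
        by (simp add: cost_at_most_def generic_code_def double_code_def)
      ultimately show ?thesis by blast
    next
      case 4
      have "computes_montgomery c P (Program (generic_code t0 17) (6, 9, 16, 18))"
        (is "computes_montgomery c P ?p")
      proof (rule computes_montgomeryI, goal_cases)
        case (2 Q R U0 U1 V0 V1 v)
        note QR = 2(1)[folded e_def]
        show ?case
          using run_generic_code[OF char2, of 17 c U0 U1 V0 V1 t0] dbl[OF QR 2(2)] 4
            sum_coordinates_generic[OF ch e QR 2(2,3) t]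
          unfolding 2(4)[symmetric] e_def[symmetric] by (simp add: Let_def)
      qed (simp add: wf_code)
      moreover have "cost_at_most ?p 4 5 1 1"
        by (simp add: cost_at_most_def generic_code_def double_code_def)
      ultimately show ?thesis by blast
    qed
  qed
  moreover have "\<exists>p. computes_montgomery c P p \<and> cost_at_most p 4 4 1 2"
    using normalized
  proof
    \<comment> \<open>No further case distinction: \<open>sum_coordinates_fst\<close> and
      \<open>sum_coordinates_snd\<close> put no condition on the remaining coordinate of P.\<close>
    assume "t0 = 1"
    have "computes_montgomery c P (Program (unified_code t1 2 3) (6, 9, 13, 17))"
        (is "computes_montgomery c P ?p")
    proof (rule computes_montgomeryI, goal_cases)
      case (2 Q R U0 U1 V0 V1 v)
      note QR = 2(1)[folded e_def]
      have t': "(1, to_ac t1) \<in> kummer P" using t \<open>t0 = 1\<close> by simp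
      show ?case
        using run_unified_code(1)[of c U0 U1 V0 V1 t1] dbl[OF QR 2(2)]
          sum_coordinates_fst[OF ch e QR 2(2,3) t']
        unfolding 2(4)[symmetric] e_def[symmetric] by (simp add: Let_def)
    qed (simp add: wf_code)
    moreover have "cost_at_most ?p 4 4 1 2"
      by (simp add: cost_at_most_def unified_code_def double_code_def)
    ultimately show ?thesis by blast
  next
    assume "t1 = 1"
    have "computes_montgomery c P (Program (unified_code t0 3 2) (6, 9, 17, 13))"
        (is "computes_montgomery c P ?p")
    proof (rule computes_montgomeryI, goal_cases)
      case (2 Q R U0 U1 V0 V1 v)
      note QR = 2(1)[folded e_def]
      have t': "(to_ac t0, 1) \<in> kummer P" using t \<open>t1 = 1\<close> by simp
      show ?case
        using run_unified_code(2)[of c U0 U1 V0 V1 t0] dbl[OF QR 2(2)]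
          sum_coordinates_snd[OF ch e QR 2(2,3) t']
        unfolding 2(4)[symmetric] e_def[symmetric] by (simp add: Let_def)
    qed (simp add: wf_code)
    moreover have "cost_at_most ?p 4 4 1 2"
      by (simp add: cost_at_most_def unified_code_def double_code_def)
    ultimately show ?thesis by blast
  qed
  ultimately show ?thesis unfolding P_def by blast
qed

end
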